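(* Randomized selection (finding the $t$-th smallest of $n$ elements, for any given $t$) is possible by a comparison-based algorithm with expected linear work while achieving either expected fragile complexity of the selected element $\mathbb{E}[f_{\mathrm{med}}(n)]=O(\log\log n)$ and of the remaining elements $\mathbb{E}[f_{\mathrm{rem}}(n)]=O(\sqrt n)$, or $\mathbb{E}[f_{\mathrm{med}}(n)]=O\!\left(\frac{\log n}{\log\log n}\right)$ and $\mathbb{E}[f_{\mathrm{rem}}(n)]=O(\log^2 n)$.
   Context: Elements come from a totally ordered set and are accessed only through comparisons; the algorithm always returns the correct element. $f_{\mathrm{med}}(n)$ is the number of comparisons in which the selected element participates, and $\mathbb{E}[f_{\mathrm{rem}}(n)]$ denotes the maximum over non-selected elements of the expected number of comparisons that element participates in. Work is the total number of comparisons. *)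

theory Defs
  imports "HOL-Probability.Probability" "HOL-Library.Landau_Symbols"
begin

text \<open>
  The n input elements are named by their positions 0, ..., n - 1. Their total order is an
  arbitrary linear order r on these names, where (i, j) in r means that element i is at most
  element j. The algorithm does not know r; its only access to r is through comparisons, so its
  behaviour on n elements of an arbitrary totally ordered set is determined by the order that
  they induce on the positions.

  An algorithm for a fixed input size and a fixed target rank is a randomized decision tree.
  Being an element of a datatype, it terminates in every execution. A comparison of i with itself
  or with a name outside the input has an answer that does not depend on r, so permitting it
  gives no additional power.
\<close>

datatype algo =
    Return nat
  | Compare nat nat (if_le: algo) (if_gt: algo)
  | Random "algo pmf"

text \<open>
  The joint distribution of the returned element and the list of all comparisons performed.
\<close>

primrec run :: "nat rel \<Rightarrow> algo \<Rightarrow> (nat \<times> (nat \<times> nat) list) pmf" where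
  "run r (Return k) = return_pmf (k, [])"
| "run r (Compare i j a b) =
     map_pmf (\<lambda>(k, cs). (k, (i, j) # cs)) (if (i, j) \<in> r then run r a else run r b)"
| "run r (Random p) = join_pmf (map_pmf (run r) p)"

lemma run_Random: "run r (Random p) = bind_pmf p (run r)"
  by (simp add: bind_eq_join_pmf)

definition participation :: "nat \<Rightarrow> (nat \<times> nat) list \<Rightarrow> nat" where
  "participation i cs = length (filter (\<lambda>(a, b). a = i \<or> b = i) cs)"

text \<open>
  Ranks start at 1, as the order is reflexive and hence \<open>i \<in> under r i\<close>.
\<close>

definition kth_smallest :: "nat rel \<Rightarrow> nat \<Rightarrow> nat" where
  "kth_smallest r t = (THE i. i \<in> Field r \<and> card (under r i) = t)"

lemma kth_smallest_ex1:
  assumes lin: "linear_order_on {..<n} r" and t: "t \<in> {1..n}"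
  shows "\<exists>!i. i \<in> Field r \<and> card (under r i) = t"
proof -
  have sub: "r \<subseteq> {..<n} \<times> {..<n}" and rf: "\<And>i. i < n \<Longrightarrow> (i, i) \<in> r"
    and tr: "trans r" and an: "antisym r" and tot: "total_on {..<n} r"
    using lin by (auto simp: order_on_defs refl_on_def)
  have Fld: "Field r = {..<n}"
    using sub rf by (force simp: Field_def)
  have under_sub: "under r i \<subseteq> {..<n}" for i
    using sub by (auto simp: under_def)
  have fin: "finite (under r i)" for i
    using under_sub finite_subset by blast
  have less: "card (under r i) < card (under r j)" if "(i, j) \<in> r" "i \<noteq> j" for i j
  proof (rule psubset_card_mono[OF fin])
    have "j < n" using that sub by auto
    then show "under r i \<subset> under r j"
      using that rf[of j] tr an by (auto simp: under_def dest: transD antisymD)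
  qed
  have inj: "inj_on (\<lambda>i. card (under r i)) {..<n}"
  proof (rule inj_onI, rule ccontr)
    fix i j assume ij: "i \<in> {..<n}" "j \<in> {..<n}" "card (under r i) = card (under r j)" "i \<noteq> j"
    then have "(i, j) \<in> r \<or> (j, i) \<in> r"
      using tot by (auto simp: total_on_def)
    then show False using less[of i j] less[of j i] ij by auto
  qed
  have "(\<lambda>i. card (under r i)) ` {..<n} \<subseteq> {1..n}"
  proof safe
    fix i assume "i < n"
    then have "card (under r i) > 0"
      using rf[of i] fin by (auto simp: card_gt_0_iff under_def)
    moreover have "card (under r i) \<le> n"
      using card_mono[OF _ under_sub[of i]] by simp
    ultimately show "card (under r i) \<in> {1..n}" by simp
  qed
  then have img: "(\<lambda>i. card (under r i)) ` {..<n} = {1..n}"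
    by (rule card_subset_eq[rotated]) (auto simp: card_image[OF inj])
  from t obtain i where "i \<in> {..<n}" "card (under r i) = t"
    unfolding img[symmetric] by blast
  then show ?thesis
    using inj by (intro ex1I[of _ i]) (auto simp: Fld dest: inj_onD)
qed

text \<open>
  A selection algorithm is a family of such trees, given the input size n and the rank t.
\<close>

definition selects_correctly :: "(nat \<Rightarrow> nat \<Rightarrow> algo) \<Rightarrow> bool" where
  "selects_correctly A \<longleftrightarrow>
     (\<forall>n. \<forall>t\<in>{1..n}. \<forall>r. linear_order_on {..<n} r \<longrightarrow>
        (\<forall>(k, cs) \<in> set_pmf (run r (A n t)). k = kth_smallest r t))"

text \<open>
  The three cost measures are worst cases, over all ranks t and all inputs r of size n, of
  expectations over the random choices of the algorithm. They are extended nonnegative reals,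
  so that an infinite expectation is not mistaken for a small one.
\<close>

definition exp_work :: "(nat \<Rightarrow> nat \<Rightarrow> algo) \<Rightarrow> nat \<Rightarrow> ennreal" where
  "exp_work A n =
     (SUP t\<in>{1..n}. SUP r\<in>{r. linear_order_on {..<n} r}.
        \<integral>\<^sup>+ (k, cs). of_nat (length cs) \<partial>measure_pmf (run r (A n t)))"

definition exp_fmed :: "(nat \<Rightarrow> nat \<Rightarrow> algo) \<Rightarrow> nat \<Rightarrow> ennreal" where
  "exp_fmed A n =
     (SUP t\<in>{1..n}. SUP r\<in>{r. linear_order_on {..<n} r}.
        \<integral>\<^sup>+ (k, cs). of_nat (participation (kth_smallest r t) cs) \<partial>measure_pmf (run r (A n t)))"

definition exp_frem :: "(nat \<Rightarrow> nat \<Rightarrow> algo) \<Rightarrow> nat \<Rightarrow> ennreal" where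
  "exp_frem A n =
     (SUP t\<in>{1..n}. SUP r\<in>{r. linear_order_on {..<n} r}. SUP i\<in>{..<n} - {kth_smallest r t}.
        \<integral>\<^sup>+ (k, cs). of_nat (participation i cs) \<partial>measure_pmf (run r (A n t)))"

definition finite_bigo :: "(nat \<Rightarrow> ennreal) \<Rightarrow> (nat \<Rightarrow> real) \<Rightarrow> bool" where
  "finite_bigo F g \<longleftrightarrow> (\<forall>n. F n < \<top>) \<and> (\<lambda>n. enn2real (F n)) \<in> O(g)"

end

theory Submission
  imports Defs "HOL-Real_Asymp.Real_Asymp"
begin

text \<open>
  Both bounds come from one algorithm with a tuning parameter \<open>d\<close>. On \<open>m\<close> remaining elements, a
  round draws a random subset \<open>S\<close> of expected size \<open>d ^ 3\<close>, where \<open>d ^ 6 \<le> m\<close>, and sorts it by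
  comparing all pairs. All elements are then compared with the two elements of \<open>S\<close> whose ranks
  in \<open>S\<close> differ by \<open>u\<close> from the expected rank of the target, for a random offset \<open>u\<close> of order
  \<open>d\<^sup>2\<close>. By Chebyshev's inequality they enclose the target, and only \<open>O(m / d)\<close> elements, with
  probability \<open>1 - O(1 / d)\<close>. A third pivot, uniformly random, guarantees progress in every round.

  An element is in \<open>S\<close> with probability \<open>d ^ 3 / m\<close>, so it takes part in \<open>O(d ^ 3)\<close> expected
  comparisons per round. The target is a pivot only if it is in \<open>S\<close> (probability
  \<open>d ^ 3 / m\<close>), its sample rank is off by at least \<open>d\<^sup>2\<close> (probability \<open>1 / d\<close>), and \<open>u\<close> hits
  that deviation (probability \<open>1 / d\<^sup>2\<close>). These events combine to probability \<open>1 / m\<close>, so that the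
  target takes part in \<open>O(1)\<close> expected comparisons per round. The choices \<open>d = m powr (1/6)\<close> and
  \<open>d = ln m powr (1/3)\<close> yield the two trade-offs.
\<close>

subsection \<open>Random subsets\<close>

text \<open>Independent inclusion, rather than a sample of fixed size, makes the moments computable
  by adding one element of \<open>X\<close> at a time, and makes the event that \<open>x\<close> is
  drawn independent of the rest of the sample.\<close>

definition rsubset :: "real \<Rightarrow> 'a set \<Rightarrow> 'a set pmf" where
  "rsubset q X = map_pmf (\<lambda>f. {x \<in> X. f x}) (Pi_pmf X False (\<lambda>_. bernoulli_pmf q))"

lemma set_rsubset: "S \<in> set_pmf (rsubset q X) \<Longrightarrow> S \<subseteq> X"
  by (auto simp: rsubset_def)

lemma nn_integral_rsubset_empty [simp]: "(\<integral>\<^sup>+S. f S \<partial>rsubset q {}) = f {}"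
  by (simp add: rsubset_def)

text \<open>Conditioning on the independent coin of \<open>x\<close>. This is the induction step of
  all moment computations below.\<close>

lemma nn_integral_rsubset_insert:
  fixes f :: "'a set \<Rightarrow> ennreal"
  assumes "finite A" "x \<notin> A" "q \<in> {0..1}"
  shows "(\<integral>\<^sup>+S. f S \<partial>rsubset q (insert x A)) =
    (\<integral>\<^sup>+S. ennreal q * f (insert x S) + ennreal (1 - q) * f S \<partial>rsubset q A)"
proof -
  let ?P = "Pi_pmf A False (\<lambda>_. bernoulli_pmf q)"
  have eq: "{y. y \<noteq> x \<longrightarrow> y \<in> A \<and> g y} = insert x {y \<in> A. g y}"
    "{y. y \<noteq> x \<and> (y \<noteq> x \<longrightarrow> y \<in> A \<and> g y)} = {y \<in> A. g y}" for g
    using assms(2) by auto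
  have "(\<integral>\<^sup>+S. f S \<partial>rsubset q (insert x A)) =
      (\<integral>\<^sup>+b. \<integral>\<^sup>+g. f {y. (y = x \<or> y \<in> A) \<and> (if y = x then b else g y)} \<partial>?P \<partial>bernoulli_pmf q)"
    using assms by (simp add: rsubset_def Pi_pmf_insert nn_integral_pair_pmf' case_prod_unfold)
  also have "\<dots> = ennreal q * (\<integral>\<^sup>+g. f (insert x {y \<in> A. g y}) \<partial>?P)
      + ennreal (1 - q) * (\<integral>\<^sup>+g. f {y \<in> A. g y} \<partial>?P)"
    using assms by (simp add: nn_integral_bernoulli_pmf eq mult.commute)
  also have "\<dots> = (\<integral>\<^sup>+S. ennreal q * f (insert x S) + ennreal (1 - q) * f S \<partial>rsubset q A)"
    by (simp add: rsubset_def nn_integral_add nn_integral_cmult)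
  finally show ?thesis .
qed

section \<open>Moments of the sample size and Chebyshev's inequality\<close>

lemma convex_ennreal:
  assumes "q \<in> {0..1}" "0 \<le> a" "0 \<le> b"
  shows "ennreal q * ennreal a + ennreal (1 - q) * ennreal b = ennreal (q * a + (1 - q) * b)"
  using assms by (simp add: ennreal_mult ennreal_plus)

lemma rsubset_card_mean:
  assumes "finite X" "q \<in> {0..1}"
  shows "(\<integral>\<^sup>+S. ennreal (card S) \<partial>rsubset q X) = ennreal (q * card X)"
  using assms(1)
proof induction
  case (insert x A)
  have "(\<integral>\<^sup>+S. ennreal (card S) \<partial>rsubset q (insert x A)) =
    (\<integral>\<^sup>+S. ennreal (card S) + ennreal q \<partial>rsubset q A)"
    unfolding nn_integral_rsubset_insert[OF insert.hyps assms(2)]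
  proof (intro nn_integral_cong_AE AE_pmfI)
    fix S assume "S \<in> set_pmf (rsubset q A)"
    then have "S \<subseteq> A" by (rule set_rsubset)
    then have "finite S" "x \<notin> S" using insert.hyps finite_subset by auto
    then show "ennreal q * ennreal (card (insert x S)) + ennreal (1 - q) * ennreal (card S) =
        ennreal (card S) + ennreal q"
      using assms(2) by (simp add: convex_ennreal ennreal_plus[symmetric] algebra_simps del: ennreal_plus)
  qed
  also have "\<dots> = ennreal (q * card A) + ennreal q"
    using insert.IH by (simp add: nn_integral_add)
  also have "\<dots> = ennreal (q * card (insert x A))"
    using insert.hyps assms(2) by (simp add: ennreal_plus[symmetric] algebra_simps del: ennreal_plus)
  finally show ?case .
qed simp

text \<open>The exact second moment of this binomial variable is
  \<open>(q * N)^2 + q * (1 - q) * N\<close> with \<open>N = card X\<close>; the bound drops the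
  term \<open>- q^2 * N\<close>.\<close>

lemma rsubset_card_square:
  assumes "finite X" "q \<in> {0..1}"
  shows "(\<integral>\<^sup>+S. ennreal ((real (card S))\<^sup>2) \<partial>rsubset q X) \<le> ennreal ((q * card X)\<^sup>2 + q * card X)"
  using assms(1)
proof induction
  case (insert x A)
  have "(\<integral>\<^sup>+S. ennreal ((real (card S))\<^sup>2) \<partial>rsubset q (insert x A)) =
    (\<integral>\<^sup>+S. ennreal ((real (card S))\<^sup>2) + (ennreal (2 * q) * ennreal (card S) + ennreal q) \<partial>rsubset q A)"
    unfolding nn_integral_rsubset_insert[OF insert.hyps assms(2)]
  proof (intro nn_integral_cong_AE AE_pmfI)
    fix S assume "S \<in> set_pmf (rsubset q A)"
    then have "S \<subseteq> A" by (rule set_rsubset)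
    then have "finite S" "x \<notin> S" using insert.hyps finite_subset by auto
    then have "q * (real (card (insert x S)))\<^sup>2 + (1 - q) * (real (card S))\<^sup>2 =
        (real (card S))\<^sup>2 + (2 * q * card S + q)"
      by (simp add: power2_eq_square algebra_simps)
    moreover have "ennreal (2 * q * card S) = ennreal (2 * q) * ennreal (card S)"
      using assms(2) by (intro ennreal_mult) auto
    ultimately show "ennreal q * ennreal ((real (card (insert x S)))\<^sup>2) + ennreal (1 - q) * ennreal ((real (card S))\<^sup>2) =
        ennreal ((real (card S))\<^sup>2) + (ennreal (2 * q) * ennreal (card S) + ennreal q)"
      using assms(2) by (simp add: convex_ennreal)
  qed
  also have "\<dots> = (\<integral>\<^sup>+S. ennreal ((real (card S))\<^sup>2) \<partial>rsubset q A) + ennreal (2 * q * (q * card A) + q)"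
    using assms(2) insert.hyps
    by (simp add: nn_integral_add nn_integral_cmult rsubset_card_mean ennreal_mult)
  also have "\<dots> \<le> ennreal ((q * card A)\<^sup>2 + q * card A) + ennreal (2 * q * (q * card A) + q)"
    by (intro add_mono insert.IH order.refl)
  also have "\<dots> = ennreal (((q * card A)\<^sup>2 + q * card A) + (2 * q * (q * card A) + q))"
    using assms(2) by (intro ennreal_plus[symmetric]) auto
  also have "\<dots> \<le> ennreal ((q * card (insert x A))\<^sup>2 + q * card (insert x A))"
    using insert.hyps by (intro ennreal_leI) (simp add: power2_eq_square algebra_simps)
  finally show ?case .
qed simp

text \<open>Variances of independent coins add up. In the induction, an element of \<open>B\<close>
  contributes q(1 - q), which is at most q, and an element outside \<open>B\<close> contributes
  nothing.\<close>

lemma rsubset_card_variance: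
  assumes "finite X" "q \<in> {0..1}" "B \<subseteq> X"
  shows "(\<integral>\<^sup>+S. ennreal ((real (card (S \<inter> B)) - q * card B)\<^sup>2) \<partial>rsubset q X) \<le> ennreal (q * card B)"
  using assms(1,3)
proof (induction arbitrary: B)
  case (insert x A)
  let ?V = "\<lambda>S. real (card (S \<inter> (B - {x}))) - q * card (B - {x})"
  have IH: "(\<integral>\<^sup>+S. ennreal ((?V S)\<^sup>2) \<partial>rsubset q A) \<le> ennreal (q * card (B - {x}))"
    using insert.prems by (intro insert.IH) auto
  have finB: "finite B" using insert.prems insert.hyps(1) by (meson finite.insertI finite_subset)
  show ?case
  proof (cases "x \<in> B")
    case False
    have "(\<integral>\<^sup>+S. ennreal ((real (card (S \<inter> B)) - q * card B)\<^sup>2) \<partial>rsubset q (insert x A)) =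
      (\<integral>\<^sup>+S. ennreal ((real (card (S \<inter> B)) - q * card B)\<^sup>2) \<partial>rsubset q A)"
      using False assms(2) unfolding nn_integral_rsubset_insert[OF insert.hyps assms(2)]
      by (intro nn_integral_cong) (simp add: convex_ennreal algebra_simps)
    with IH False show ?thesis by simp
  next
    case True
    have cB: "card B = Suc (card (B - {x}))"
      using True finB by (metis card.remove)
    have "(\<integral>\<^sup>+S. ennreal ((real (card (S \<inter> B)) - q * card B)\<^sup>2) \<partial>rsubset q (insert x A)) =
      (\<integral>\<^sup>+S. ennreal ((?V S)\<^sup>2) + ennreal (q * (1 - q)) \<partial>rsubset q A)"
      unfolding nn_integral_rsubset_insert[OF insert.hyps assms(2)]
    proof (intro nn_integral_cong_AE AE_pmfI)
      fix S assume "S \<in> set_pmf (rsubset q A)"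
      then have "S \<subseteq> A" by (rule set_rsubset)
      then have S: "finite S" "x \<notin> S" using insert.hyps finite_subset by auto
      have 1: "insert x S \<inter> B = insert x (S \<inter> (B - {x}))" and 2: "S \<inter> B = S \<inter> (B - {x})"
        using True S by auto
      \<comment> \<open>With v for \<open>?V S\<close>, this is q(v + 1 - q)^2 + (1 - q)(v - q)^2 =
        v^2 + q(1 - q); the mixed terms cancel because the centred coin has mean 0.\<close>
      have "q * (real (card (insert x S \<inter> B)) - q * card B)\<^sup>2 + (1 - q) * (real (card (S \<inter> B)) - q * card B)\<^sup>2
         = (?V S)\<^sup>2 + q * (1 - q)"
        unfolding 1 2 cB using S by (simp add: power2_eq_square algebra_simps)
      then show "ennreal q * ennreal ((real (card (insert x S \<inter> B)) - q * card B)\<^sup>2) +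
          ennreal (1 - q) * ennreal ((real (card (S \<inter> B)) - q * card B)\<^sup>2) =
          ennreal ((?V S)\<^sup>2) + ennreal (q * (1 - q))"
        using assms(2) by (simp add: convex_ennreal ennreal_plus[symmetric] del: ennreal_plus)
    qed
    also have "\<dots> = (\<integral>\<^sup>+S. ennreal ((?V S)\<^sup>2) \<partial>rsubset q A) + ennreal (q * (1 - q))"
      by (simp add: nn_integral_add)
    also have "\<dots> \<le> ennreal (q * card (B - {x})) + ennreal (q * (1 - q))"
      by (intro add_mono IH order.refl)
    also have "\<dots> = ennreal (q * card (B - {x}) + q * (1 - q))"
      using assms(2) by (simp add: ennreal_plus)
    also have "\<dots> \<le> ennreal (q * card B)"
      unfolding cB using assms(2) by (intro ennreal_leI) (auto simp: algebra_simps)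
    finally show ?thesis .
  qed
qed simp

lemma rsubset_chebyshev:
  assumes "finite X" "q \<in> {0..1}" "B \<subseteq> X" "0 < a"
  shows "(\<integral>\<^sup>+S. of_bool (a \<le> \<bar>real (card (S \<inter> B)) - q * card B\<bar>) \<partial>rsubset q X) \<le> ennreal (q * card B / a\<^sup>2)"
proof -
  have "(\<integral>\<^sup>+S. of_bool (a \<le> \<bar>real (card (S \<inter> B)) - q * card B\<bar>) \<partial>rsubset q X)
      \<le> (\<integral>\<^sup>+S. ennreal (1 / a\<^sup>2) * ennreal ((real (card (S \<inter> B)) - q * card B)\<^sup>2) \<partial>rsubset q X)"
  proof (intro nn_integral_mono)
    fix S
    let ?v = "real (card (S \<inter> B)) - q * card B"
    have "1 \<le> 1 / a\<^sup>2 * ?v\<^sup>2" if "a \<le> \<bar>?v\<bar>"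
    proof -
      have "a\<^sup>2 \<le> ?v\<^sup>2" using power_mono[OF that, of 2] assms(4) by simp
      then show ?thesis using assms(4) by (simp add: field_simps)
    qed
    then show "of_bool (a \<le> \<bar>?v\<bar>) \<le> ennreal (1 / a\<^sup>2) * ennreal (?v\<^sup>2)"
      by (auto simp: ennreal_mult[symmetric] ennreal_1[symmetric] simp del: ennreal_1 intro!: ennreal_leI)
  qed
  also have "\<dots> = ennreal (1 / a\<^sup>2) * (\<integral>\<^sup>+S. ennreal ((real (card (S \<inter> B)) - q * card B)\<^sup>2) \<partial>rsubset q X)"
    by (simp add: nn_integral_cmult)
  also have "\<dots> \<le> ennreal (1 / a\<^sup>2) * ennreal (q * card B)"
    by (intro mult_left_mono rsubset_card_variance assms) auto
  also have "\<dots> = ennreal (q * card B / a\<^sup>2)"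
    using assms by (subst ennreal_mult[symmetric]) auto
  finally show ?thesis .
qed

text \<open>Given that \<open>x\<close> is drawn, the rest of the sample is still an independent
  sample of \<open>X - {x}\<close> at the same rate. This multiplies the rate \<open>q\<close> with
  probabilities that depend only on the other elements.\<close>

lemma nn_integral_rsubset_mem:
  fixes f :: "'a set \<Rightarrow> ennreal"
  assumes "finite X" "x \<in> X" "q \<in> {0..1}"
  shows "(\<integral>\<^sup>+S. of_bool (x \<in> S) * f (S - {x}) \<partial>rsubset q X) =
    ennreal q * (\<integral>\<^sup>+S. f S \<partial>rsubset q (X - {x}))"
proof -
  have "insert x (X - {x}) = X" using assms by auto
  then have "(\<integral>\<^sup>+S. of_bool (x \<in> S) * f (S - {x}) \<partial>rsubset q X) =
      (\<integral>\<^sup>+S. ennreal q * (of_bool (x \<in> insert x S) * f (insert x S - {x}))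
         + ennreal (1 - q) * (of_bool (x \<in> S) * f (S - {x})) \<partial>rsubset q (X - {x}))"
    using nn_integral_rsubset_insert[of "X - {x}" x q "\<lambda>S. of_bool (x \<in> S) * f (S - {x})"] assms by auto
  also have "\<dots> = (\<integral>\<^sup>+S. ennreal q * f S \<partial>rsubset q (X - {x}))"
  proof (intro nn_integral_cong_AE AE_pmfI)
    fix S assume "S \<in> set_pmf (rsubset q (X - {x}))"
    then have "x \<notin> S" using set_rsubset by blast
    then show "ennreal q * (of_bool (x \<in> insert x S) * f (insert x S - {x}))
         + ennreal (1 - q) * (of_bool (x \<in> S) * f (S - {x})) = ennreal q * f S"
      by simp
  qed
  finally show ?thesis by (simp add: nn_integral_cmult)
qed

subsection \<open>Decision trees and their expected cost\<close>

text \<open>A non-adaptive batch of comparisons. The continuation receives the set of queried pairs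
  that were answered positively, which can then be used as a relation in place of the order.\<close>

primrec ask :: "(nat \<times> nat) list \<Rightarrow> ((nat \<times> nat) set \<Rightarrow> algo) \<Rightarrow> algo" where
  "ask [] k = k {}"
| "ask (q # qs) k = Compare (fst q) (snd q) (ask qs (\<lambda>a. k (insert q a))) (ask qs k)"

lemma run_ask:
  "run r (ask qs k) = map_pmf (\<lambda>(v, cs). (v, qs @ cs)) (run r (k (set qs \<inter> r)))"
proof (induction qs arbitrary: k)
  case (Cons q qs)
  then show ?case
    by (cases q) (auto simp: pmf.map_comp o_def case_prod_unfold)
qed simp

text \<open>A weight \<open>c\<close> on comparisons treats all cost measures at once: weight 1
  gives the work, the indicator of the comparisons involving \<open>i\<close> gives the
  participation of \<open>i\<close>.\<close>

definition tot :: "('a \<Rightarrow> nat) \<Rightarrow> 'a list \<Rightarrow> nat" where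
  "tot c cs = sum_list (map c cs)"

lemma tot_append [simp]: "tot c (xs @ ys) = tot c xs + tot c ys"
  by (simp add: tot_def)

lemma tot_one: "tot (\<lambda>_. 1) cs = length cs"
  by (simp add: tot_def sum_list_triv)

lemma tot_participation: "tot (\<lambda>(a, b). of_bool (a = i \<or> b = i)) cs = participation i cs"
  by (induction cs) (auto simp: tot_def participation_def)

definition ecost :: "(nat \<times> nat \<Rightarrow> nat) \<Rightarrow> nat rel \<Rightarrow> algo \<Rightarrow> ennreal" where
  "ecost c r T = (\<integral>\<^sup>+(k, cs). of_nat (tot c cs) \<partial>measure_pmf (run r T))"

lemma ecost_Return [simp]: "ecost c r (Return k) = 0"
  by (simp add: ecost_def tot_def)

lemma ecost_ask: "ecost c r (ask qs k) = of_nat (tot c qs) + ecost c r (k (set qs \<inter> r))"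
  by (simp add: ecost_def run_ask case_prod_unfold nn_integral_add)

lemma ecost_Random: "ecost c r (Random (map_pmf f p)) = (\<integral>\<^sup>+w. ecost c r (f w) \<partial>p)"
  by (simp add: ecost_def run_Random bind_map_pmf del: run.simps)

subsection \<open>Ranks\<close>

definition rnk :: "nat rel \<Rightarrow> nat set \<Rightarrow> nat \<Rightarrow> nat" where
  "rnk r X y = card {z \<in> X. (z, y) \<in> r}"

text \<open>The candidates \<open>P\<close> are separate from \<open>X\<close> because comparing
  \<open>X\<close> with \<open>P\<close> reveals the ranks in \<open>X\<close> of the elements of
  \<open>P\<close> only.\<close>

definition pick :: "nat rel \<Rightarrow> nat set \<Rightarrow> nat set \<Rightarrow> nat \<Rightarrow> nat" where
  "pick r X P t = (THE y. y \<in> P \<and> rnk r X y = t)"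

text \<open>The algorithm sees only the answers \<open>Q \<inter> r\<close>. This lemma and its
  analogues below show that its computations agree with those in \<open>r\<close> once the relevant
  pairs have been asked.\<close>

lemma rnk_restrict: "X \<times> {y} \<subseteq> Q \<Longrightarrow> rnk (Q \<inter> r) X y = rnk r X y"
  by (auto simp: rnk_def intro!: arg_cong[where f = card])

lemma pick_restrict: "X \<times> P \<subseteq> Q \<Longrightarrow> pick (Q \<inter> r) X P t = pick r X P t"
  unfolding pick_def by (rule arg_cong[where f = The]) (use rnk_restrict[of X _ Q r] in fastforce)

locale ordered_names =
  fixes r :: "nat rel" and n :: nat
  assumes lin: "linear_order_on {..<n} r"
begin

lemma r_refl: "x < n \<Longrightarrow> (x, x) \<in> r"
  using lin by (auto simp: order_on_defs refl_on_def)

lemma r_total: "x < n \<Longrightarrow> y < n \<Longrightarrow> (x, y) \<in> r \<or> (y, x) \<in> r"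
  using lin r_refl by (cases "x = y") (auto simp: order_on_defs total_on_def)

lemma r_antisym: "(x, y) \<in> r \<Longrightarrow> (y, x) \<in> r \<Longrightarrow> x = y"
  using lin by (auto simp: order_on_defs dest: antisymD)

lemma r_trans: "(x, y) \<in> r \<Longrightarrow> (y, z) \<in> r \<Longrightarrow> (x, z) \<in> r"
  using lin by (auto simp: order_on_defs dest: transD)

lemma fin: "X \<subseteq> {..<n} \<Longrightarrow> finite X"
  using finite_subset by blast

lemma rnk_mono: "X \<subseteq> {..<n} \<Longrightarrow> (x, y) \<in> r \<Longrightarrow> rnk r X x \<le> rnk r X y"
  unfolding rnk_def by (intro card_mono) (auto intro: fin r_trans)

lemma rnk_strict:
  assumes "X \<subseteq> {..<n}" "y \<in> X" "(x, y) \<in> r" "x \<noteq> y"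
  shows "rnk r X x < rnk r X y"
  unfolding rnk_def
proof (rule psubset_card_mono)
  show "{z \<in> X. (z, x) \<in> r} \<subset> {z \<in> X. (z, y) \<in> r}"
    using assms r_refl[of y] by (auto intro: r_trans dest: r_antisym)
qed (use fin assms in auto)

lemma rnk_le_iff:
  assumes "X \<subseteq> {..<n}" "x \<in> X" "y < n"
  shows "(x, y) \<in> r \<longleftrightarrow> rnk r X x \<le> rnk r X y"
proof
  assume "rnk r X x \<le> rnk r X y"
  then show "(x, y) \<in> r"
    using rnk_strict[OF assms(1,2), of y] r_total[of x y] r_refl[of x] assms by fastforce
qed (use rnk_mono assms in auto)

lemma inj_rnk: "X \<subseteq> {..<n} \<Longrightarrow> inj_on (rnk r X) X"
  by (rule inj_onI) (metis r_antisym lessThan_iff order.refl rnk_le_iff subsetD)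

lemma rnk_le_card: "X \<subseteq> {..<n} \<Longrightarrow> rnk r X x \<le> card X"
  unfolding rnk_def by (intro card_mono) (auto intro: fin)

lemma rnk_pos: "X \<subseteq> {..<n} \<Longrightarrow> x \<in> X \<Longrightarrow> 0 < rnk r X x"
  unfolding rnk_def using r_refl by (auto simp: card_gt_0_iff intro: fin)

lemma rnk_image:
  assumes X: "X \<subseteq> {..<n}"
  shows "rnk r X ` X = {1..card X}"
proof (rule card_subset_eq)
  show "rnk r X ` X \<subseteq> {1..card X}"
    using rnk_le_card[OF X] rnk_pos[OF X] by (auto simp: Suc_le_eq)
  show "card (rnk r X ` X) = card {1..card X}"
    by (simp add: card_image[OF inj_rnk[OF X]])
qed simp

lemma pick_eqI:
  assumes "X \<subseteq> {..<n}" "P \<subseteq> X" "y \<in> P" "rnk r X y = t"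
  shows "pick r X P t = y"
  unfolding pick_def
proof (rule the_equality)
  show "z = y" if "z \<in> P \<and> rnk r X z = t" for z
    using inj_onD[OF inj_rnk[OF assms(1)], of z y] that assms by auto
qed (use assms in simp)

lemma pick_props:
  assumes "X \<subseteq> {..<n}" "t \<in> {1..card X}"
  shows "pick r X X t \<in> X" "rnk r X (pick r X X t) = t"
proof -
  obtain y where "y \<in> X" "rnk r X y = t"
    using rnk_image[OF assms(1)] assms(2) by (metis imageE)
  with pick_eqI[OF assms(1) order.refl this] show "pick r X X t \<in> X" "rnk r X (pick r X X t) = t"
    by auto
qed

lemma pick_kth_smallest: "pick r {..<n} {..<n} t = kth_smallest r t"
proof -
  have "Field r = {..<n}"
    using lin r_refl by (auto simp: order_on_defs Field_def refl_on_def)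
  moreover have "{z \<in> {..<n}. (z, y) \<in> r} = under r y" for y
    using lin by (auto simp: under_def order_on_defs refl_on_def)
  ultimately show ?thesis by (simp add: pick_def kth_smallest_def rnk_def)
qed

end

subsection \<open>The algorithm\<close>

definition low :: "nat rel \<Rightarrow> nat set \<Rightarrow> nat set \<Rightarrow> nat \<Rightarrow> nat set" where
  "low r X P t = {x \<in> X. \<exists>p\<in>P. rnk r X p < t \<and> (x, p) \<in> r}"

text \<open>Pivots on either side of rank \<open>t\<close> are themselves discarded: below, by
  reflexivity of the order; above, by the condition \<open>x \<noteq> p\<close>.\<close>

definition mid :: "nat rel \<Rightarrow> nat set \<Rightarrow> nat set \<Rightarrow> nat \<Rightarrow> nat set" where
  "mid r X P t = {x \<in> X. \<forall>p\<in>P. (rnk r X p < t \<longrightarrow> (x, p) \<notin> r) \<and>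
     (t < rnk r X p \<longrightarrow> (x, p) \<in> r \<and> x \<noteq> p)}"

lemma low_restrict: "X \<times> P \<subseteq> Q \<Longrightarrow> low (Q \<inter> r) X P t = low r X P t"
  unfolding low_def by (intro Collect_cong conj_cong bex_cong refl) (auto simp: rnk_restrict subset_iff)

lemma mid_restrict: "X \<times> P \<subseteq> Q \<Longrightarrow> mid (Q \<inter> r) X P t = mid r X P t"
  unfolding mid_def by (intro Collect_cong conj_cong ball_cong refl) (auto simp: rnk_restrict subset_iff)

lemma mid_subset: "mid r X P t \<subseteq> X"
  by (auto simp: mid_def)

text \<open>Integers are used because \<open>a - u\<close> may be negative, in which case there is
  simply no pivot on the lower side.\<close>

definition pivots :: "nat rel \<Rightarrow> nat set \<Rightarrow> int \<Rightarrow> int \<Rightarrow> nat set" where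
  "pivots r S a u = {y \<in> S. int (rnk r S y) = a - u \<or> int (rnk r S y) = a + u}"

lemma pivots_restrict: "S \<times> S \<subseteq> Q \<Longrightarrow> pivots (Q \<inter> r) S a u = pivots r S a u"
  unfolding pivots_def by (intro Collect_cong conj_cong refl) (auto simp: rnk_restrict subset_iff)

definition pairs :: "nat set \<Rightarrow> nat set \<Rightarrow> (nat \<times> nat) list" where
  "pairs A B = List.product (sorted_list_of_set A) (sorted_list_of_set B)"

lemma set_pairs [simp]: "finite A \<Longrightarrow> finite B \<Longrightarrow> set (pairs A B) = A \<times> B"
  by (simp add: pairs_def)

section \<open>Reduction to the elements between the pivots\<close>

context ordered_names
begin

text \<open>The target lies above all pivots of smaller rank and strictly below all pivots of larger
  rank, so it survives. The elements up to the target are those in \<open>low\<close> together with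
  the survivors up to it, so its rank drops by exactly the size of \<open>low\<close>.\<close>

lemma mid_props:
  assumes X: "X \<subseteq> {..<n}" and P: "P \<subseteq> X" and t: "t \<in> {1..card X}"
    and no: "\<And>p. p \<in> P \<Longrightarrow> rnk r X p \<noteq> t"
  defines "X' \<equiv> mid r X P t" and "t' \<equiv> t - card (low r X P t)"
  shows "t' \<in> {1..card X'}" "pick r X' X' t' = pick r X X t"
proof -
  define e where "e = pick r X X t"
  have e: "e \<in> X" "rnk r X e = t" unfolding e_def by (rule pick_props[OF X t])+
  have en: "e < n" using e X by auto
  have above: "(e, p) \<in> r \<and> e \<noteq> p" if "p \<in> P" "t < rnk r X p" for p
    using that e rnk_le_iff[OF X e(1), of p] P X by auto
  have below: "(e, p) \<notin> r" "(p, e) \<in> r" if "p \<in> P" "rnk r X p < t" for p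
    using that e rnk_le_iff[OF X e(1), of p] rnk_le_iff[OF X _ en, of p] P X by auto
  have eX': "e \<in> X'"
    using e above below by (auto simp: X'_def mid_def)
  have X'n: "X' \<subseteq> {..<n}" unfolding X'_def using mid_subset X by (rule order.trans)
  have split: "{z \<in> X. (z, e) \<in> r} = low r X P t \<union> {z \<in> X'. (z, e) \<in> r}"
  proof (intro equalityI subsetI)
    fix z assume z: "z \<in> {z \<in> X. (z, e) \<in> r}"
    show "z \<in> low r X P t \<union> {z \<in> X'. (z, e) \<in> r}"
    proof (cases "z \<in> low r X P t")
      case False
      have "(z, p) \<in> r \<and> z \<noteq> p" if "p \<in> P" "t < rnk r X p" for p
        using above[OF that] z r_trans r_antisym by blast
      with False z show ?thesis by (auto simp: X'_def mid_def low_def)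
    qed simp
  next
    fix z assume "z \<in> low r X P t \<union> {z \<in> X'. (z, e) \<in> r}"
    then show "z \<in> {z \<in> X. (z, e) \<in> r}"
      using below r_trans by (auto simp: low_def X'_def mid_def)
  qed
  have "card {z \<in> X. (z, e) \<in> r} = card (low r X P t) + card {z \<in> X'. (z, e) \<in> r}"
    unfolding split
    by (rule card_Un_disjoint) (auto simp: low_def X'_def mid_def intro: fin X finite_subset[OF _ fin[OF X]])
  then have "rnk r X' e = t'"
    using e(2) by (simp add: rnk_def t'_def)
  then show "t' \<in> {1..card X'}" "pick r X' X' t' = pick r X X t"
    using rnk_pos[OF X'n eX'] rnk_le_card[OF X'n, of e] pick_eqI[OF X'n order.refl eX'] e_def by auto
qed

text \<open>A pivot that is not the target discards at least itself. This is what bounds the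
  recursion depth by the number of elements.\<close>

lemma mid_psubset:
  assumes X: "X \<subseteq> {..<n}" and P: "P \<subseteq> X" "p \<in> P" and "rnk r X p \<noteq> t"
  shows "mid r X P t \<subset> X"
proof -
  have "p \<notin> mid r X P t"
  proof
    assume "p \<in> mid r X P t"
    then have "rnk r X p < t \<longrightarrow> (p, p) \<notin> r" "\<not> t < rnk r X p" using P(2) by (auto simp: mid_def)
    then show False using assms r_refl[of p] by auto
  qed
  then show ?thesis using mid_subset[of r X P t] P by auto
qed

end

text \<open>The rate makes \<open>d ^ 3\<close> the expected sample size. The offset takes
  \<open>d\<^sup>2\<close> values, so a given deviation is hit with probability at most
  \<open>1 / d\<^sup>2\<close>. Its least value exceeds \<open>d\<^sup>2\<close> by 2 to absorb
  rounding and the target's own contribution to its sample rank.\<close>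

definition choices :: "nat \<Rightarrow> nat set \<Rightarrow> (nat set \<times> nat \<times> nat) pmf" where
  "choices d X = pair_pmf (rsubset (d ^ 3 / card X) X)
     (pair_pmf (pmf_of_set {d\<^sup>2 + 2..2 * d\<^sup>2 + 1}) (pmf_of_set X))"

text \<open>The centre is the floor of the expected number of sampled elements among the
  \<open>t\<close> smallest. The extra element \<open>p\<close> keeps the pivot set nonempty
  whatever the sample is.\<close>

definition all_pivots :: "nat rel \<Rightarrow> nat \<Rightarrow> nat set \<Rightarrow> nat \<Rightarrow> nat set \<times> nat \<times> nat \<Rightarrow> nat set" where
  "all_pivots r d X t = (\<lambda>(S, u, p). insert p (pivots r S (int (d ^ 3 * t div card X)) (int u)))"

lemma all_pivots_restrict:
  "S \<times> S \<subseteq> Q \<Longrightarrow> all_pivots (Q \<inter> r) d X t (S, w) = all_pivots r d X t (S, w)"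
  by (simp add: all_pivots_def pivots_restrict case_prod_unfold)

definition continue :: "nat rel \<Rightarrow> nat set \<Rightarrow> nat \<Rightarrow> (nat set \<Rightarrow> nat \<Rightarrow> algo) \<Rightarrow> nat set \<Rightarrow> algo" where
  "continue r X t F P = (if \<exists>p\<in>P. rnk r X p = t then Return (pick r X P t)
     else F (mid r X P t) (t - card (low r X P t)))"

definition round_of ::
    "nat \<Rightarrow> nat set \<Rightarrow> nat \<Rightarrow> (nat set \<Rightarrow> nat \<Rightarrow> algo) \<Rightarrow> nat set \<times> nat \<times> nat \<Rightarrow> algo" where
  "round_of d X t F w = ask (pairs (fst w) (fst w)) (\<lambda>a.
     let P = all_pivots a d X t w in ask (pairs X P) (\<lambda>b. continue b X t F P))"

text \<open>
  The argument \<open>k\<close> bounds the recursion depth. Since every round discards at least one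
  element, the bound \<open>card X\<close> is never exhausted.
\<close>

primrec select :: "(nat \<Rightarrow> nat) \<Rightarrow> nat \<Rightarrow> nat \<Rightarrow> nat set \<Rightarrow> nat \<Rightarrow> algo" where
  "select D M 0 X t = ask (pairs X X) (\<lambda>a. Return (pick a X X t))"
| "select D M (Suc k) X t =
     (if card X < M then ask (pairs X X) (\<lambda>a. Return (pick a X X t))
      else Random (map_pmf (round_of (D (card X)) X t (select D M k)) (choices (D (card X)) X)))"

lemma continue_restrict:
  assumes "X \<times> P \<subseteq> Q"
  shows "continue (Q \<inter> r) X t F P = continue r X t F P"
proof -
  have "(\<exists>p\<in>P. rnk (Q \<inter> r) X p = t) \<longleftrightarrow> (\<exists>p\<in>P. rnk r X p = t)"
    using assms by (intro bex_cong refl arg_cong2[where f = "(=)"] rnk_restrict) auto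
  then show ?thesis
    by (simp only: continue_def pick_restrict[OF assms] mid_restrict[OF assms] low_restrict[OF assms])
qed

lemma all_pivots_subset:
  assumes "finite X" "X \<noteq> {}" "w \<in> set_pmf (choices d X)"
  shows "all_pivots r d X t w \<subseteq> X" "fst w \<subseteq> X" "all_pivots r d X t w \<noteq> {}"
  using assms by (auto simp: choices_def all_pivots_def pivots_def dest!: set_rsubset)

text \<open>The first batch of answers determines the pivots and the second the ranks of the pivots
  and the comparisons with them, so both answer sets can be replaced by \<open>r\<close>. The
  analysis of a round can therefore work with the true order.\<close>

lemma run_round_of:
  fixes r :: "nat rel" and t :: nat
  assumes "finite X" "X \<noteq> {}" "w \<in> set_pmf (choices d X)"
  defines "P \<equiv> all_pivots r d X t w"
  shows "run r (round_of d X t F w) =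
    map_pmf (\<lambda>(v, cs). (v, pairs (fst w) (fst w) @ pairs X P @ cs)) (run r (continue r X t F P))"
proof -
  have "fst w \<subseteq> X" "P \<subseteq> X" using all_pivots_subset[OF assms(1-3)] by (auto simp: P_def)
  then have "finite (fst w)" "finite P" using assms(1) finite_subset by auto
  moreover have "all_pivots ((fst w \<times> fst w) \<inter> r) d X t w = P"
    unfolding P_def by (cases w) (simp add: all_pivots_restrict)
  ultimately show ?thesis
    using assms(1) by (simp add: round_of_def run_ask pmf.map_comp o_def case_prod_unfold continue_restrict)
qed

lemma ecost_round_of:
  fixes r :: "nat rel" and t :: nat
  assumes "finite X" "X \<noteq> {}" "w \<in> set_pmf (choices d X)"
  defines "P \<equiv> all_pivots r d X t w"
  shows "ecost c r (round_of d X t F w) =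
    of_nat (tot c (pairs (fst w) (fst w)) + tot c (pairs X P)) + ecost c r (continue r X t F P)"
  unfolding P_def ecost_def run_round_of[OF assms(1-3)]
  by (simp add: case_prod_unfold nn_integral_add add.assoc)

section \<open>Correctness\<close>

context ordered_names
begin

text \<open>Holds for every depth bound \<open>k\<close>, since an exhausted bound leads to
  comparing all pairs. Otherwise either a pivot is the target, or \<open>mid_props\<close> shows
  that the subproblem has the same target.\<close>

lemma select_correct:
  assumes "X \<subseteq> {..<n}" "t \<in> {1..card X}" "(v, cs) \<in> set_pmf (run r (select D M k X t))"
  shows "v = pick r X X t"
  using assms
proof (induction k arbitrary: X t v cs)
  case 0
  then show ?case by (auto simp: run_ask pick_restrict fin)
next
  case (Suc k)
  have finX: "finite X" "X \<noteq> {}" using Suc.prems fin by auto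
  show ?case
  proof (cases "card X < M")
    case True
    then show ?thesis using Suc.prems by (auto simp: run_ask pick_restrict fin)
  next
    case False
    then obtain w where w: "w \<in> set_pmf (choices (D (card X)) X)"
      and "(v, cs) \<in> set_pmf (run r (round_of (D (card X)) X t (select D M k) w))"
      using Suc.prems(3) by (auto simp: run_Random bind_map_pmf simp del: run.simps)
    then obtain ds where ds: "(v, ds) \<in> set_pmf (run r (continue r X t (select D M k)
        (all_pivots r (D (card X)) X t w)))"
      by (auto simp: run_round_of[OF finX w])
    let ?P = "all_pivots r (D (card X)) X t w"
    have P: "?P \<subseteq> X" using all_pivots_subset(1)[OF finX w] .
    show ?thesis
    proof (cases "\<exists>p\<in>?P. rnk r X p = t")
      case True
      then obtain p where p: "p \<in> ?P" "rnk r X p = t" by blast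
      have "v = pick r X ?P t" using True ds by (simp add: continue_def)
      also have "\<dots> = p" by (rule pick_eqI[OF Suc.prems(1) P p])
      also have "\<dots> = pick r X X t"
        using pick_eqI[OF Suc.prems(1) order.refl _ p(2)] p(1) P by auto
      finally show ?thesis .
    next
      case False
      let ?X = "mid r X ?P t" and ?t = "t - card (low r X ?P t)"
      have no: "\<And>p. p \<in> ?P \<Longrightarrow> rnk r X p \<noteq> t" using False by blast
      note mp = mid_props[OF Suc.prems(1) P Suc.prems(2) no]
      have "(v, ds) \<in> set_pmf (run r (select D M k ?X ?t))"
        using ds False by (simp add: continue_def)
      then have "v = pick r ?X ?X ?t"
        using mid_subset[of r X ?P t] Suc.prems(1) by (intro Suc.IH[of ?X ?t v ds] mp(1)) auto
      with mp(2) show ?thesis by simp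
    qed
  qed
qed

end

subsection \<open>The cost of a round\<close>

lemma div_bounds:
  fixes a b :: nat
  assumes "0 < b"
  shows "real (a div b) \<le> real a / real b" "real a / real b < real (a div b) + 1"
  using floor_correct[of "real a / real b"] unfolding floor_divide_of_nat_eq by simp_all

section \<open>From sample counts to the positions of the pivots\<close>

context ordered_names
begin

definition lowest :: "nat set \<Rightarrow> nat \<Rightarrow> nat set" where
  "lowest X j = {y \<in> X. rnk r X y \<le> j}"

lemma lowest_subset: "lowest X j \<subseteq> X"
  by (auto simp: lowest_def)

lemma card_lowest:
  assumes "X \<subseteq> {..<n}"
  shows "card (lowest X j) = min j (card X)"
proof -
  have "rnk r X ` lowest X j = {1..min j (card X)}"
  proof -
    have "rnk r X ` lowest X j = rnk r X ` X \<inter> {..j}" by (auto simp: lowest_def)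
    also have "\<dots> = {1..min j (card X)}" unfolding rnk_image[OF assms] by auto
    finally show ?thesis .
  qed
  moreover have "card (rnk r X ` lowest X j) = card (lowest X j)"
    by (intro card_image inj_on_subset[OF inj_rnk[OF assms] lowest_subset])
  ultimately show ?thesis by simp
qed

text \<open>Counts of sampled elements, which Chebyshev's inequality controls, are translated into
  the rank in \<open>X\<close> of the \<open>k\<close>-th smallest element of the sample.\<close>

lemma sample_element:
  assumes X: "X \<subseteq> {..<n}" and S: "S \<subseteq> X" and k: "card (S \<inter> lowest X i) < k" "k \<le> card (S \<inter> lowest X j)"
  obtains p where "p \<in> S" "rnk r S p = k" "i < rnk r X p" "rnk r X p \<le> j"
proof -
  have Sn: "S \<subseteq> {..<n}" using X S by auto
  note finS = fin[OF Sn]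
  have "k \<le> card S" using k(2) card_mono[of S "S \<inter> lowest X j"] finS by auto
  then have kS: "k \<in> {1..card S}" using k(1) by auto
  define p where "p = pick r S S k"
  have p: "p \<in> S" "rnk r S p = k"
    unfolding p_def by (rule pick_props[OF Sn kS])+
  then have pX: "p \<in> X" "p < n" using S X by auto
  show thesis
  proof (rule that[OF p])
    show "i < rnk r X p"
    proof (rule ccontr)
      assume "\<not> ?thesis"
      \<comment> \<open>Otherwise all \<open>k\<close> sampled elements up to \<open>p\<close> would
        be among the \<open>i\<close> smallest.\<close>
      then have "{z \<in> S. (z, p) \<in> r} \<subseteq> S \<inter> lowest X i"
        using S rnk_mono[OF X, of _ p] by (force simp: lowest_def)
      then have "card {z \<in> S. (z, p) \<in> r} \<le> card (S \<inter> lowest X i)"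
        by (intro card_mono) (use finS in auto)
      then show False using k(1) p(2) by (simp add: rnk_def)
    qed
    show "rnk r X p \<le> j"
    proof (rule ccontr)
      assume gt: "\<not> ?thesis"
      \<comment> \<open>Otherwise \<open>p\<close> would come after all sampled elements among the
        \<open>j\<close> smallest and have sample rank greater than \<open>k\<close>.\<close>
      then have "insert p (S \<inter> lowest X j) \<subseteq> {z \<in> S. (z, p) \<in> r}"
        using S p r_refl[OF pX(2)] rnk_le_iff[OF X _ pX(2)] by (auto simp: lowest_def)
      then have "card (insert p (S \<inter> lowest X j)) \<le> card {z \<in> S. (z, p) \<in> r}"
        by (intro card_mono) (use finS in auto)
      moreover have "p \<notin> lowest X j" using gt by (simp add: lowest_def)
      ultimately show False using k(2) p(2) finS by (simp add: rnk_def)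
    qed
  qed
qed

text \<open>When the three sample counts are typical, the pivots of sample ranks
  \<open>a - u\<close> and \<open>a + u\<close> have ranks in (t - w, t] and (t, t + w], so
  survivors lie within \<open>w\<close> of the target. The bound \<open>3 * d\<^sup>2 + 2\<close> on
  \<open>q * w\<close> is the sum of the deviation \<open>d\<^sup>2\<close>, the largest offset
  \<open>2 * d\<^sup>2 + 1\<close> and 1 for rounding.\<close>

lemma card_mid_le:
  fixes d u w t :: nat
  assumes X: "X \<subseteq> {..<n}" and S: "S \<subseteq> X" and t: "t \<in> {1..card X}"
    and u: "u \<in> {d\<^sup>2 + 2..2 * d\<^sup>2 + 1}"
  defines "q \<equiv> real d ^ 3 / card X" and "a \<equiv> d ^ 3 * t div card X"
  assumes w: "3 * real (d\<^sup>2) + 2 < q * w"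
    and dev: "\<And>j. j \<in> {t - w, t, t + w} \<Longrightarrow> \<bar>real (card (S \<inter> lowest X j)) - q * card (lowest X j)\<bar> < d\<^sup>2"
    and P: "pivots r S (int a) (int u) \<subseteq> P" and no: "\<And>p. p \<in> P \<Longrightarrow> rnk r X p \<noteq> t"
  shows "card (mid r X P t) \<le> 2 * w"
proof -
  have m: "0 < card X" using t by auto
  have u': "real (d\<^sup>2) + 2 \<le> u" "real u \<le> 2 * real (d\<^sup>2) + 1" using u by (simp_all flip: of_nat_power)
  have a: "real a \<le> q * t" "q * t < real a + 1"
  proof -
    have "q * t = real (d ^ 3 * t) / card X" by (simp add: q_def)
    then show "real a \<le> q * t" "q * t < real a + 1"
      using div_bounds[of "card X" "d ^ 3 * t"] m by (simp_all add: a_def)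
  qed
  have ct: "card (lowest X t) = t" using t by (simp add: card_lowest[OF X])
  have devt: "\<bar>real (card (S \<inter> lowest X t)) - q * t\<bar> < d\<^sup>2" using dev[of t] ct by simp
  have pos: "(y, p) \<in> r \<longleftrightarrow> rnk r X y \<le> rnk r X p" if "y \<in> X" "p \<in> S" for y p
    using that X S rnk_le_iff[OF X] by blast
  have lower: "t - w < rnk r X y" if y: "y \<in> mid r X P t" for y
  proof (cases "t \<le> w")
    \<comment> \<open>Here truncated subtraction makes \<open>t - w\<close> equal to 0, and the
      claim is positivity of ranks; a lower pivot may not exist.\<close>
    case True
    then show ?thesis using rnk_pos[OF X, of y] y by (auto simp: mid_def)
  next
    case False
    then have "card (lowest X (t - w)) = t - w" using t by (simp add: card_lowest[OF X])
    then have "real (card (S \<inter> lowest X (t - w))) < q * (real t - real w) + d\<^sup>2"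
      using dev[of "t - w"] False by (simp add: of_nat_diff)
    also have "\<dots> < real a - real u" using w u' a by (simp add: algebra_simps)
    finally have 1: "card (S \<inter> lowest X (t - w)) < a - u" "u < a" by linarith+
    have 2: "a - u \<le> card (S \<inter> lowest X t)" using devt u' a by linarith
    obtain p where p: "p \<in> S" "rnk r S p = a - u" "t - w < rnk r X p" "rnk r X p \<le> t"
      using sample_element[OF X S 1(1) 2] .
    then have "p \<in> P" using P 1(2) by (auto simp: pivots_def)
    with no p(4) have "rnk r X p < t" by (metis le_neq_implies_less)
    with y \<open>p \<in> P\<close> have "(y, p) \<notin> r" by (auto simp: mid_def)
    with p pos[of y p] y show ?thesis by (auto simp: mid_def)
  qed
  have upper: "rnk r X y \<le> t + w" if y: "y \<in> mid r X P t" for y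
  proof (cases "card X \<le> t + w")
    case True
    then show ?thesis using rnk_le_card[OF X, of y] by simp
  next
    case False
    then have "card (lowest X (t + w)) = t + w" using t by (simp add: card_lowest[OF X])
    then have "q * (real t + real w) - d\<^sup>2 < real (card (S \<inter> lowest X (t + w)))"
      using dev[of "t + w"] by simp
    moreover have "real a + real u < q * (real t + real w) - d\<^sup>2" using w u' a by (simp add: algebra_simps)
    ultimately have 2: "a + u \<le> card (S \<inter> lowest X (t + w))" by linarith
    have 1: "card (S \<inter> lowest X t) < a + u" using devt u' a by linarith
    obtain p where p: "p \<in> S" "rnk r S p = a + u" "t < rnk r X p" "rnk r X p \<le> t + w"
      using sample_element[OF X S 1 2] .
    then have "p \<in> P" using P by (auto simp: pivots_def)
    with y p have "(y, p) \<in> r" by (auto simp: mid_def)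
    with p pos[of y p] y show ?thesis by (auto simp: mid_def)
  qed
  have "card (mid r X P t) = card (rnk r X ` mid r X P t)"
    by (intro card_image[symmetric] inj_on_subset[OF inj_rnk[OF X] mid_subset])
  also have "\<dots> \<le> card {t - w<..t + w}"
    by (intro card_mono) (use lower upper in auto)
  also have "\<dots> \<le> 2 * w" by simp
  finally show ?thesis .
qed

lemma card_pivots:
  assumes "S \<subseteq> {..<n}"
  shows "card (pivots r S a u) \<le> 2"
proof -
  have "card (pivots r S a u) = card ((\<lambda>y. int (rnk r S y)) ` pivots r S a u)"
    using inj_rnk[OF assms] by (intro card_image[symmetric]) (auto simp: pivots_def inj_on_def)
  also have "\<dots> \<le> card {a - u, a + u}"
    by (intro card_mono) (auto simp: pivots_def)
  also have "\<dots> \<le> 2" by (simp add: card_insert_if)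
  finally show ?thesis .
qed

lemma card_all_pivots:
  assumes "fst w \<subseteq> {..<n}"
  shows "card (all_pivots r d X t w) \<le> 3"
proof -
  have "finite (pivots r (fst w) a u)" for a u
    by (rule finite_subset[OF _ fin[OF assms]]) (auto simp: pivots_def)
  then show ?thesis
    using card_pivots[OF assms] by (auto simp: all_pivots_def card_insert_if case_prod_unfold
      intro: le_SucI simp: numeral_3_eq_3 numeral_2_eq_2)
qed

end

section \<open>Expected progress and expected cost of one round\<close>

lemma nn_integral_choices:
  "(\<integral>\<^sup>+w. f w \<partial>choices d X) = (\<integral>\<^sup>+S. \<integral>\<^sup>+u. \<integral>\<^sup>+p. f (S, u, p) \<partial>pmf_of_set X
     \<partial>pmf_of_set {d\<^sup>2 + 2..2 * d\<^sup>2 + 1} \<partial>rsubset (real d ^ 3 / real (card X)) X)"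
  by (simp add: choices_def nn_integral_pair_pmf')

lemma nn_integral_choices_fst:
  "(\<integral>\<^sup>+w. f (fst w) \<partial>choices d X) = (\<integral>\<^sup>+S. f S \<partial>rsubset (real d ^ 3 / real (card X)) X)"
  by (simp add: nn_integral_choices)

lemma length_pairs: "finite A \<Longrightarrow> finite B \<Longrightarrow> length (pairs A B) = card A * card B"
  by (simp add: pairs_def)

lemma participation_pairs:
  assumes "finite A" "finite B"
  shows "participation i (pairs A B) \<le> of_bool (i \<in> A) * card B + of_bool (i \<in> B) * card A"
proof -
  have "distinct (pairs A B)"
    using assms by (simp add: pairs_def distinct_product)
  then have "participation i (pairs A B) = card {(a, b). (a, b) \<in> A \<times> B \<and> (a = i \<or> b = i)}"
    using assms by (subst participation_def, subst distinct_card[symmetric])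
      (auto intro!: arg_cong[where f = card])
  also have "\<dots> \<le> card ((({i} \<inter> A) \<times> B) \<union> (A \<times> ({i} \<inter> B)))"
    using assms by (intro card_mono) auto
  also have "\<dots> \<le> card (({i} \<inter> A) \<times> B) + card (A \<times> ({i} \<inter> B))"
    by (rule card_Un_le)
  also have "\<dots> = of_bool (i \<in> A) * card B + of_bool (i \<in> B) * card A"
    by (auto simp: card_cartesian_product)
  finally show ?thesis .
qed

text \<open>The condition \<open>d ^ 6 \<le> card X\<close> keeps the all-pairs sorting of a sample
  of expected size \<open>d ^ 3\<close> linear in \<open>card X\<close>, and makes the sampling rate
  a probability.\<close>

locale round_setup = ordered_names +
  fixes X :: "nat set" and t d :: nat
  assumes X: "X \<subseteq> {..<n}" and t: "t \<in> {1..card X}" and d: "0 < d" "d ^ 6 \<le> card X"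
begin

abbreviation "q \<equiv> real d ^ 3 / real (card X)"
abbreviation "P \<equiv> all_pivots r d X t"

lemma finX: "finite X" and X_pos: "0 < card X" and X_ne: "X \<noteq> {}"
  using fin[OF X] t by auto

lemma d_bounds: "d ^ 3 \<le> d ^ 6" "real d ^ 6 \<le> card X" "1 \<le> real d ^ 3" "real d ^ 3 \<le> real d ^ 6"
  using d power_increasing[of 3 6 d] power_increasing[of 3 6 "real d"] one_le_power[of "real d" 3]
  by (auto simp flip: of_nat_power)

lemma q: "q \<in> {0..1}"
proof -
  have "real d ^ 3 \<le> card X" using d_bounds by linarith
  then show ?thesis using X_pos by simp
qed

lemma q_card: "q * card X = real d ^ 3"
  using X_pos by simp

text \<open>The variance is at most \<open>d ^ 3\<close>, and
  \<open>d ^ 3 / (d\<^sup>2)\<^sup>2\<close> is \<open>1 / d\<close>. The sample may come from a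
  subset \<open>Y\<close> at the rate belonging to \<open>X\<close>, because the case
  \<open>Y = X - {i}\<close> arises after conditioning on \<open>i\<close> being drawn.\<close>

lemma chebyshev:
  assumes "B \<subseteq> Y" "Y \<subseteq> X"
  shows "(\<integral>\<^sup>+S. of_bool (real (d\<^sup>2) \<le> \<bar>real (card (S \<inter> B)) - q * card B\<bar>) \<partial>rsubset q Y) \<le> ennreal (1 / real d)"
proof -
  have "(\<integral>\<^sup>+S. of_bool (real (d\<^sup>2) \<le> \<bar>real (card (S \<inter> B)) - q * card B\<bar>) \<partial>rsubset q Y)
      \<le> ennreal (q * card B / (real (d\<^sup>2))\<^sup>2)"
    using d finite_subset[OF assms(2) finX] assms(1) q by (intro rsubset_chebyshev) auto
  also have "\<dots> \<le> ennreal (1 / real d)"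
  proof (rule ennreal_leI)
    have "card B \<le> card X" using assms finX by (intro card_mono) auto
    then have "q * card B \<le> real d ^ 3"
      using mult_left_mono[of "real (card B)" "card X" q] q q_card by auto
    then have "q * card B / (real (d\<^sup>2))\<^sup>2 \<le> real d ^ 3 / (real (d\<^sup>2))\<^sup>2"
      by (intro divide_right_mono) auto
    also have "\<dots> = 1 / d" using d by (simp add: field_simps eval_nat_numeral)
    finally show "q * card B / (real (d\<^sup>2))\<^sup>2 \<le> 1 / d" .
  qed
  finally show ?thesis by simp
qed

text \<open>By \<open>card_mid_le\<close>, a round that neither finds the target nor shrinks the set
  has an atypical sample count at one of three thresholds. A union bound over Chebyshev estimates
  finishes the proof.\<close>

lemma shrink:
  assumes "6 \<le> d"
  shows "(\<integral>\<^sup>+w. of_bool ((\<forall>p\<in>P w. rnk r X p \<noteq> t) \<and> 10 * card X div d < card (mid r X (P w) t)) \<partial>choices d X)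
    \<le> ennreal (1 / 2)"
proof -
  \<comment> \<open>This makes \<open>q * w\<close> exceed \<open>4 * d\<^sup>2\<close>, hence
    \<open>3 * d\<^sup>2 + 2\<close>. The added 1 contributes 2 to \<open>2 * w\<close>, which is at
    most \<open>2 * card X / d\<close>; this turns the factor 8 into 10.\<close>
  define w where "w = 4 * card X div d + 1"
  define J where "J = {t - w, t, t + w}"
  define bad where "bad j S = (real (d\<^sup>2) \<le> \<bar>real (card (S \<inter> lowest X j)) - q * card (lowest X j)\<bar>)" for j S
  have "real (4 * card X) / d < w"
    using d div_bounds(2)[of d "4 * card X"] by (simp add: w_def)
  then have "q * (real (4 * card X) / d) \<le> q * w"
    using q by (intro mult_left_mono) auto
  moreover have "q * (real (4 * card X) / d) = 4 * real (d\<^sup>2)"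
    using d X_pos by (simp add: field_simps eval_nat_numeral)
  moreover have "2 < real (d\<^sup>2)"
    using power_mono[of 6 "real d" 2] assms by simp
  ultimately have w: "3 * real (d\<^sup>2) + 2 < q * w" by linarith
  have "2 * w \<le> 10 * card X div d"
  proof -
    have "d \<le> d ^ 6" using d by (simp add: self_le_power)
    then have "d \<le> card X" using d by simp
    moreover have "4 * card X div d * d \<le> 4 * card X" by (rule div_times_less_eq_dividend)
    moreover have "2 * w * d = 2 * (4 * card X div d * d) + 2 * d"
      unfolding w_def by (simp only: distrib_left distrib_right mult.assoc mult_1)
    ultimately have "2 * w * d \<le> 10 * card X" by linarith
    then show ?thesis using d by (simp add: less_eq_div_iff_mult_less_eq)
  qed
  note w2 = this
  have key: "\<exists>j\<in>J. bad j S" if "S \<subseteq> X" "u \<in> {d\<^sup>2 + 2..2 * d\<^sup>2 + 1}"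
      "\<forall>p\<in>P (S, u, p'). rnk r X p \<noteq> t" "10 * card X div d < card (mid r X (P (S, u, p')) t)" for S u p'
  proof (rule ccontr)
    assume "\<not> ?thesis"
    then have "\<bar>real (card (S \<inter> lowest X j)) - q * card (lowest X j)\<bar> < d\<^sup>2" if "j \<in> {t - w, t, t + w}" for j
      using that by (auto simp: bad_def J_def not_le)
    then have "card (mid r X (P (S, u, p')) t) \<le> 2 * w"
      using w that(3) by (intro card_mid_le[OF X that(1) t that(2)]) (auto simp: all_pivots_def)
    with that(4) w2 show False by linarith
  qed
  have "(\<integral>\<^sup>+w. of_bool ((\<forall>p\<in>P w. rnk r X p \<noteq> t) \<and> 10 * card X div d < card (mid r X (P w) t)) \<partial>choices d X)
      \<le> (\<integral>\<^sup>+w. (\<Sum>j\<in>J. of_bool (bad j (fst w))) \<partial>choices d X)"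
  proof (intro nn_integral_mono_AE AE_pmfI)
    fix w assume "w \<in> set_pmf (choices d X)"
    then have "fst w \<subseteq> X" "fst (snd w) \<in> {d\<^sup>2 + 2..2 * d\<^sup>2 + 1}"
      using d by (auto simp: choices_def dest!: set_rsubset)
    with key[of "fst w" "fst (snd w)" "snd (snd w)"]
    have "\<exists>j\<in>J. bad j (fst w)" if "\<forall>p\<in>P w. rnk r X p \<noteq> t" "10 * card X div d < card (mid r X (P w) t)"
      using that by simp
    moreover have "1 \<le> (\<Sum>j\<in>J. of_bool (bad j (fst w)) :: ennreal)" if "j \<in> J" "bad j (fst w)" for j
      using member_le_sum[of j J "\<lambda>j. of_bool (bad j (fst w)) :: ennreal"] that by (simp add: J_def)
    ultimately show "of_bool ((\<forall>p\<in>P w. rnk r X p \<noteq> t) \<and> 10 * card X div d < card (mid r X (P w) t))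
        \<le> (\<Sum>j\<in>J. of_bool (bad j (fst w)) :: ennreal)"
      by auto
  qed
  also have "\<dots> = (\<Sum>j\<in>J. \<integral>\<^sup>+S. of_bool (bad j S) \<partial>rsubset q X)"
    by (subst nn_integral_sum) (auto simp: nn_integral_choices)
  also have "\<dots> \<le> (\<Sum>j\<in>J. ennreal (1 / real d))"
    unfolding bad_def by (intro sum_mono chebyshev lowest_subset order.refl)
  also have "\<dots> = ennreal (card J * (1 / d))"
    by (simp add: ennreal_of_nat_eq_real_of_nat flip: ennreal_mult)
  also have "\<dots> \<le> ennreal (1 / 2)"
  proof (rule ennreal_leI)
    \<comment> \<open>The total failure probability is at most 3 / d, which is where
      \<open>6 \<le> d\<close> enters.\<close>
    have "real (card J) \<le> 3" unfolding J_def by (simp add: card_insert_if)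
    then show "real (card J) * (1 / real d) \<le> 1 / 2"
      using assms by (simp add: field_simps)
  qed
  finally show ?thesis .
qed

text \<open>Sorting the sample costs the second moment of its size, at most
  \<open>d ^ 6 + d ^ 3\<close> and so at most \<open>2 * card X\<close>; comparing with at most
  three pivots adds \<open>3 * card X\<close>.\<close>

lemma round_work:
  "(\<integral>\<^sup>+w. of_nat (tot (\<lambda>_. 1) (pairs (fst w) (fst w)) + tot (\<lambda>_. 1) (pairs X (P w))) \<partial>choices d X)
     \<le> ennreal (5 * real (card X))"
proof -
  have "(\<integral>\<^sup>+w. of_nat (tot (\<lambda>_. 1) (pairs (fst w) (fst w)) + tot (\<lambda>_. 1) (pairs X (P w))) \<partial>choices d X)
     \<le> (\<integral>\<^sup>+w. ennreal ((real (card (fst w)))\<^sup>2) + ennreal (3 * real (card X)) \<partial>choices d X)"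
  proof (intro nn_integral_mono_AE AE_pmfI)
    fix w assume w: "w \<in> set_pmf (choices d X)"
    note P = all_pivots_subset[OF finX X_ne w]
    have "finite (fst w)" "finite (P w)" using finite_subset[OF P(1) finX] finite_subset[OF P(2) finX] by auto
    moreover have "real (card (P w)) \<le> 3"
      using card_all_pivots[of w d X t] P(2) X by auto
    then have "real (card X) * real (card (P w)) \<le> real (card X) * 3" by (intro mult_left_mono) auto
    ultimately have "real (tot (\<lambda>_. 1) (pairs (fst w) (fst w)) + tot (\<lambda>_. 1) (pairs X (P w)))
        \<le> (real (card (fst w)))\<^sup>2 + 3 * card X"
      using finX by (simp add: tot_one[unfolded One_nat_def] length_pairs power2_eq_square)
    then show "of_nat (tot (\<lambda>_. 1) (pairs (fst w) (fst w)) + tot (\<lambda>_. 1) (pairs X (P w)))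
       \<le> ennreal ((real (card (fst w)))\<^sup>2) + ennreal (3 * real (card X))"
      by (simp add: ennreal_of_nat_eq_real_of_nat ennreal_leI flip: ennreal_plus)
  qed
  also have "\<dots> = (\<integral>\<^sup>+S. ennreal ((real (card S))\<^sup>2) \<partial>rsubset q X) + ennreal (3 * real (card X))"
    by (simp add: nn_integral_add nn_integral_choices)
  also have "\<dots> \<le> ennreal ((q * card X)\<^sup>2 + q * card X) + ennreal (3 * real (card X))"
    by (intro add_mono rsubset_card_square finX q order.refl)
  also have "\<dots> = ennreal ((real d ^ 3)\<^sup>2 + real d ^ 3 + 3 * real (card X))"
    unfolding q_card by (intro ennreal_plus[symmetric]) auto
  also have "\<dots> \<le> ennreal (5 * real (card X))"
  proof (rule ennreal_leI)
    have "(real d ^ 3)\<^sup>2 = real d ^ 6" by (simp flip: power_mult)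
    then show "(real d ^ 3)\<^sup>2 + real d ^ 3 + 3 * real (card X) \<le> 5 * real (card X)"
      using d_bounds by linarith
  qed
  finally show ?thesis .
qed

text \<open>The factor 2 counts \<open>i\<close> as first and as second component of a pair. Given
  that \<open>i\<close> is drawn, the others number at most \<open>d ^ 3\<close> on average, so the
  total is at most \<open>q * (2 * d ^ 3 + 2)\<close>, and \<open>d ^ 6 \<le> card X\<close> bounds
  this by 4.\<close>

lemma sample_cost:
  "(\<integral>\<^sup>+S. of_bool (i \<in> S) * ennreal (2 * real (card S)) \<partial>rsubset q X) \<le> ennreal 4"
proof (cases "i \<in> X")
  case True
  have "(\<integral>\<^sup>+S. of_bool (i \<in> S) * ennreal (2 * real (card S)) \<partial>rsubset q X) =
     (\<integral>\<^sup>+S. of_bool (i \<in> S) * (2 * ennreal (card (S - {i})) + 2) \<partial>rsubset q X)"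
  proof (intro nn_integral_cong_AE AE_pmfI)
    fix S assume "S \<in> set_pmf (rsubset q X)"
    then have "finite S" using set_rsubset finite_subset finX by metis
    obtain N where N: "card (S - {i}) = N" by blast
    show "of_bool (i \<in> S) * ennreal (2 * real (card S)) = of_bool (i \<in> S) * (2 * ennreal (card (S - {i})) + 2)"
    proof (cases "i \<in> S")
      case True
      then have "card S = N + 1"
        using N \<open>finite S\<close> by (metis Suc_eq_plus1 card.remove)
      then show ?thesis unfolding N by (simp add: ennreal_mult' distrib_left)
    qed simp
  qed
  also have "\<dots> = ennreal q * (\<integral>\<^sup>+S. 2 * ennreal (card S) + 2 \<partial>rsubset q (X - {i}))"
    using nn_integral_rsubset_mem[OF finX True q, of "\<lambda>S. 2 * ennreal (card S) + 2"] .
  also have "\<dots> = ennreal q * (2 * ennreal (q * card (X - {i})) + 2)"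
    using finX q by (simp add: nn_integral_add nn_integral_cmult rsubset_card_mean)
  also have "\<dots> = ennreal (q * (2 * (q * card (X - {i})) + 2))"
  proof -
    have "ennreal x * (2 * ennreal z + 2) = ennreal (x * (2 * z + 2))" if "0 \<le> x" "0 \<le> z" for x z
      using that by (simp add: ennreal_mult ennreal_plus)
    then show ?thesis using q by auto
  qed
  also have "\<dots> \<le> ennreal 4"
  proof (rule ennreal_leI)
    have "real (card (X - {i})) \<le> card X" using finX by (simp add: card_mono)
    then have "q * card (X - {i}) \<le> real d ^ 3"
      using mult_left_mono[of _ "real (card X)" q] q q_card by auto
    then have "q * (2 * (q * card (X - {i})) + 2) \<le> q * (2 * real d ^ 3 + 2)"
      using q by (intro mult_left_mono) auto
    also have "\<dots> = (2 * real d ^ 6 + 2 * real d ^ 3) / card X"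
      by (simp add: distrib_left add_divide_distrib mult.assoc mult.left_commute flip: power_add)
    also have "\<dots> \<le> 4"
    proof -
      have "2 * real d ^ 6 + 2 * real d ^ 3 \<le> 4 * real (card X)" using d_bounds by linarith
      then show ?thesis using X_pos by (simp add: pos_divide_le_eq)
    qed
    finally show "q * (2 * (q * card (X - {i})) + 2) \<le> 4" .
  qed
  finally show ?thesis .
next
  case False
  then have "(\<integral>\<^sup>+S. of_bool (i \<in> S) * ennreal (2 * real (card S)) \<partial>rsubset q X) = (\<integral>\<^sup>+S. 0 \<partial>rsubset q X)"
    by (intro nn_integral_cong_AE AE_pmfI) (auto dest: set_rsubset)
  then show ?thesis by simp
qed

text \<open>The 8 consists of 4 for sorting the sample, 3 for being compared with the pivots, and 1
  for being the uniform pivot, which has probability at most \<open>1 / card X\<close> and costs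
  \<open>card X\<close>. Being a sample pivot contributes the term with
  \<open>\<epsilon>\<close>.\<close>

lemma round_participation:
  fixes \<epsilon> :: real
  assumes "(\<integral>\<^sup>+w. of_bool (i \<in> pivots r (fst w) (int (d ^ 3 * t div card X)) (int (fst (snd w)))) \<partial>choices d X) \<le> ennreal \<epsilon>"
    and "0 \<le> \<epsilon>"
  defines "c \<equiv> \<lambda>(a, b). of_bool (a = i \<or> b = i)"
  shows "(\<integral>\<^sup>+w. of_nat (tot c (pairs (fst w) (fst w)) + tot c (pairs X (P w))) \<partial>choices d X)
     \<le> ennreal (8 + real (card X) * \<epsilon>)"
proof -
  define V where "V w = pivots r (fst w) (int (d ^ 3 * t div card X)) (int (fst (snd w)))" for w :: "nat set \<times> nat \<times> nat"
  have "(\<integral>\<^sup>+w. of_nat (tot c (pairs (fst w) (fst w)) + tot c (pairs X (P w))) \<partial>choices d X)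
     \<le> (\<integral>\<^sup>+w. of_bool (i \<in> fst w) * ennreal (2 * real (card (fst w))) + (3 +
       (ennreal (card X) * of_bool (i \<in> V w) + ennreal (card X) * of_bool (snd (snd w) = i))) \<partial>choices d X)"
  proof (intro nn_integral_mono_AE AE_pmfI)
    fix w assume w: "w \<in> set_pmf (choices d X)"
    note PX = all_pivots_subset[OF finX X_ne w]
    have fins: "finite (fst w)" "finite (P w)" using finite_subset[OF PX(1) finX] finite_subset[OF PX(2) finX] by auto
    have c3: "card (P w) \<le> 3" using PX X by (intro card_all_pivots) auto
    have iP: "i \<in> P w \<longleftrightarrow> i \<in> V w \<or> snd (snd w) = i"
      by (auto simp: V_def all_pivots_def case_prod_unfold)
    have "tot c (pairs (fst w) (fst w)) + tot c (pairs X (P w))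
      \<le> (of_bool (i \<in> fst w) * card (fst w) + of_bool (i \<in> fst w) * card (fst w))
        + (of_bool (i \<in> X) * card (P w) + of_bool (i \<in> P w) * card X)"
      unfolding c_def tot_participation by (intro add_mono participation_pairs fins finX)
    also have "\<dots> \<le> of_bool (i \<in> fst w) * (2 * card (fst w)) + (3 + (card X * of_bool (i \<in> V w)
        + card X * of_bool (snd (snd w) = i)))"
      using c3 iP by auto
    finally have "of_nat (tot c (pairs (fst w) (fst w)) + tot c (pairs X (P w)))
        \<le> (of_nat (of_bool (i \<in> fst w) * (2 * card (fst w)) + (3 + (card X * of_bool (i \<in> V w)
        + card X * of_bool (snd (snd w) = i)))) :: ennreal)"
      by (rule of_nat_mono)
    also have "\<dots> = of_bool (i \<in> fst w) * ennreal (2 * real (card (fst w))) + (3 +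
       (ennreal (card X) * of_bool (i \<in> V w) + ennreal (card X) * of_bool (snd (snd w) = i)))"
      by (simp add: ennreal_of_nat_eq_real_of_nat ennreal_mult')
    finally show "of_nat (tot c (pairs (fst w) (fst w)) + tot c (pairs X (P w))) \<le> \<dots>" .
  qed
  also have "\<dots> = (\<integral>\<^sup>+S. of_bool (i \<in> S) * ennreal (2 * real (card S)) \<partial>rsubset q X) + (3 +
      (ennreal (card X) * (\<integral>\<^sup>+w. of_bool (i \<in> V w) \<partial>choices d X) +
       ennreal (card X) * (\<integral>\<^sup>+w. of_bool (snd (snd w) = i) \<partial>choices d X)))"
    by (simp add: nn_integral_add nn_integral_cmult nn_integral_choices_fst[where f =  "\<lambda>S. of_bool (i \<in> S) * ennreal (2 * real (card S))", simplified])
  also have "\<dots> \<le> ennreal 4 + (3 + (ennreal (card X) * ennreal \<epsilon> + ennreal (card X) * ennreal (1 / real (card X))))"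
  proof (intro add_mono mult_left_mono sample_cost order.refl)
    show "(\<integral>\<^sup>+w. of_bool (i \<in> V w) \<partial>choices d X) \<le> ennreal \<epsilon>"
      unfolding V_def by (rule assms)
    show "(\<integral>\<^sup>+w. of_bool (snd (snd w) = i) \<partial>choices d X) \<le> ennreal (1 / real (card X))"
    proof -
      have "(\<integral>\<^sup>+p. of_bool (p = i) \<partial>pmf_of_set X) = ennreal (real (card (X \<inter> {i})) / real (card X))"
        using finX X_ne divide_ennreal[of 1 "card X"] by (simp add: nn_integral_pmf_of_set ennreal_of_nat_eq_real_of_nat
           sum.If_cases of_bool_def card_gt_0_iff)
      also have "\<dots> \<le> ennreal (1 / real (card X))"
        using card_mono[of "{i}" "X \<inter> {i}"] by (intro ennreal_leI divide_right_mono) auto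
      finally show ?thesis by (simp add: nn_integral_choices)
    qed
  qed auto
  also have "\<dots> = ennreal (8 + real (card X) * \<epsilon>)"
    using assms(2) X_pos by (simp add: ennreal_mult[symmetric] ennreal_plus[symmetric] flip: ennreal_numeral ennreal_1 del: ennreal_plus)
  finally show ?thesis .
qed

text \<open>A sample pivot must at least be drawn. The resulting cost \<open>card X * q\<close> is
  \<open>d ^ 3\<close>.\<close>

lemma pivot_prob:
  "(\<integral>\<^sup>+w. of_bool (i \<in> pivots r (fst w) (int (d ^ 3 * t div card X)) (int (fst (snd w)))) \<partial>choices d X) \<le> ennreal q"
proof (cases "i \<in> X")
  case True
  have "(\<integral>\<^sup>+w. of_bool (i \<in> pivots r (fst w) (int (d ^ 3 * t div card X)) (int (fst (snd w)))) \<partial>choices d X)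
     \<le> (\<integral>\<^sup>+w. of_bool (i \<in> fst w) * 1 \<partial>choices d X)"
    by (intro nn_integral_mono) (auto simp: pivots_def)
  also have "\<dots> = (\<integral>\<^sup>+S. of_bool (i \<in> S) * 1 \<partial>rsubset q X)"
    by (simp add: nn_integral_choices)
  also have "\<dots> = ennreal q"
    using nn_integral_rsubset_mem[OF finX True q, of "\<lambda>_. 1"] by simp
  finally show ?thesis .
next
  case False
  have "(\<integral>\<^sup>+w. of_bool (i \<in> pivots r (fst w) (int (d ^ 3 * t div card X)) (int (fst (snd w)))) \<partial>choices d X)
     = (\<integral>\<^sup>+w. 0 \<partial>choices d X)"
    using False by (intro nn_integral_cong_AE AE_pmfI) (auto simp: pivots_def choices_def dest!: set_rsubset)
  then show ?thesis by simp
qed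

text \<open>The three factors are \<open>q\<close> for being drawn, \<open>1 / d\<^sup>2\<close> for
  the offset hitting the deviation, and \<open>1 / d\<close> for the deviation being large. The last
  concerns only the sample outside \<open>i\<close> and is thus independent of the coin of
  \<open>i\<close>.\<close>

lemma pivot_prob_selected:
  assumes i: "i \<in> X" "rnk r X i = t"
  shows "(\<integral>\<^sup>+w. of_bool (i \<in> pivots r (fst w) (int (d ^ 3 * t div card X)) (int (fst (snd w)))) \<partial>choices d X)
    \<le> ennreal (1 / real (card X))"
proof -
  define a where "a = d ^ 3 * t div card X"
  define U where "U = {d\<^sup>2 + 2..2 * d\<^sup>2 + 1}"
  \<comment> \<open>For a drawn target \<open>i\<close>, the sample rank is one more than the number
    of sampled elements of \<open>B\<close>.\<close>
  define B where "B = lowest X t - {i}"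
  define f :: "nat set \<Rightarrow> ennreal" where
    "f S = ennreal (1 / real (d\<^sup>2)) * of_bool (real (d\<^sup>2) \<le> \<bar>real (card (S \<inter> B)) - q * card B\<bar>)" for S
  have U: "card U = d\<^sup>2" "U \<noteq> {}" "finite U" using d by (auto simp: U_def)
  have i_lowest: "i \<in> lowest X t" using i by (simp add: lowest_def)
  have cB: "real (card B) = real t - 1"
    unfolding B_def using i_lowest t finite_subset[OF lowest_subset finX]
    by (simp add: card_lowest[OF X] of_nat_diff)
  have a: "real a \<le> q * t" "q * t < real a + 1"
  proof -
    have "q * t = real (d ^ 3 * t) / card X" by simp
    then show "real a \<le> q * t" "q * t < real a + 1"
      using div_bounds[of "card X" "d ^ 3 * t"] X_pos by (simp_all add: a_def)
  qed
  have cBq: "q * card B = q * t - q" unfolding cB by (simp only: right_diff_distrib mult_1_right)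
  have inner: "(\<integral>\<^sup>+u. of_bool (i \<in> pivots r S (int a) (int u)) \<partial>pmf_of_set U) \<le> of_bool (i \<in> S) * f (S - {i})"
    if S: "S \<subseteq> X" for S
  proof (cases "i \<in> S")
    case True
    have finS: "finite S" using S finX finite_subset by auto
    have "{z \<in> S. (z, i) \<in> r} = insert i ((S - {i}) \<inter> B)"
      using True S i rnk_le_iff[OF X] X by (auto simp: B_def lowest_def subset_iff)
    then have rS: "rnk r S i = Suc (card ((S - {i}) \<inter> B))"
      using finS by (simp add: rnk_def)
    let ?K = "{u \<in> U. i \<in> pivots r S (int a) (int u)}"
    have "card ?K \<le> of_bool (real (d\<^sup>2) \<le> \<bar>real (card ((S - {i}) \<inter> B)) - q * card B\<bar>)"
    proof (cases "?K = {}")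
      case False
      then obtain u where u: "u \<in> U" "i \<in> pivots r S (int a) (int u)" by blast
      \<comment> \<open>All offsets are positive, so the distance of the sample rank from
        \<open>a\<close> determines \<open>u\<close>.\<close>
      have "?K \<subseteq> {u}" using u by (auto simp: pivots_def U_def)
      then have "card ?K \<le> 1" using card_mono[of "{u}" ?K] by simp
      moreover have "real (d\<^sup>2) \<le> \<bar>real (card ((S - {i}) \<inter> B)) - q * card B\<bar>"
      proof -
        have "real (rnk r S i) = real a - real u \<or> real (rnk r S i) = real a + real u"
          using u(2) by (auto simp: pivots_def)
        \<comment> \<open>Of the surplus 2, one unit pays for the floor in \<open>a\<close> and one
          for the target's own contribution to its sample rank.\<close>
        moreover have "real (d\<^sup>2) + 2 \<le> real u"
          using u(1) unfolding U_def by (simp flip: of_nat_power)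
        ultimately show ?thesis
          using rS a q cBq unfolding atLeastAtMost_iff by (elim disjE conjE) linarith+
      qed
      ultimately show ?thesis by simp
    next
      case True
      then show ?thesis by (simp only: card.empty)
    qed
    then have "real (card ?K) \<le> of_bool (real (d\<^sup>2) \<le> \<bar>real (card ((S - {i}) \<inter> B)) - q * card B\<bar>)"
      by (auto simp only: of_bool_def of_nat_le_0_iff split: if_splits)
    then have "real (card ?K) / real (d\<^sup>2) \<le> of_bool (real (d\<^sup>2) \<le> \<bar>real (card ((S - {i}) \<inter> B)) - q * card B\<bar>) / real (d\<^sup>2)"
      by (rule divide_right_mono) simp
    then have "ennreal (real (card ?K) / real (d\<^sup>2)) \<le> f (S - {i})"
      unfolding f_def by (cases "real (d\<^sup>2) \<le> \<bar>real (card ((S - {i}) \<inter> B)) - q * card B\<bar>") (simp_all only: of_bool_eq div_0 mult_1_right mult_zero_right ennreal_leI ennreal_0 ennreal_eq_0_iff[symmetric] ennreal_neg le_zero_eq)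
    moreover have "(\<integral>\<^sup>+u. of_bool (i \<in> pivots r S (int a) (int u)) \<partial>pmf_of_set U) = ennreal (real (card ?K) / real (d\<^sup>2))"
      using U d by (simp add: nn_integral_pmf_of_set divide_ennreal[symmetric] ennreal_of_nat_eq_real_of_nat
        of_bool_def sum.If_cases Int_def)
    ultimately show ?thesis using True by simp
  next
    case False
    then show ?thesis by (simp add: pivots_def)
  qed
  have "(\<integral>\<^sup>+w. of_bool (i \<in> pivots r (fst w) (int a) (int (fst (snd w)))) \<partial>choices d X)
      = (\<integral>\<^sup>+S. \<integral>\<^sup>+u. of_bool (i \<in> pivots r S (int a) (int u)) \<partial>pmf_of_set U \<partial>rsubset q X)"
    by (simp add: nn_integral_choices U_def)
  also have "\<dots> \<le> (\<integral>\<^sup>+S. of_bool (i \<in> S) * f (S - {i}) \<partial>rsubset q X)"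
    by (intro nn_integral_mono_AE AE_pmfI inner) (rule set_rsubset)
  also have "\<dots> = ennreal q * (\<integral>\<^sup>+S. f S \<partial>rsubset q (X - {i}))"
    by (rule nn_integral_rsubset_mem[OF finX i(1) q])
  also have "\<dots> \<le> ennreal q * (ennreal (1 / real (d\<^sup>2)) * ennreal (1 / real d))"
  proof (rule mult_left_mono)
    have "B \<subseteq> X - {i}" by (auto simp: B_def lowest_def)
    then show "(\<integral>\<^sup>+S. f S \<partial>rsubset q (X - {i})) \<le> ennreal (1 / real (d\<^sup>2)) * ennreal (1 / real d)"
      unfolding f_def by (subst nn_integral_cmult) (simp_all only: measurable_pmf_measure1 mult_left_mono chebyshev Diff_subset zero_le, simp)
  qed simp
  also have "\<dots> = ennreal (1 / real (card X))"
    using q d X_pos by (simp add: ennreal_mult[symmetric] power3_eq_cube power2_eq_square)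
  finally show ?thesis by (simp add: a_def)
qed

end

subsection \<open>The cost of the recursion\<close>

context ordered_names
begin

text \<open>Let m' be \<open>10 * m div D m\<close> and G be \<open>g m - g m'\<close>. A round
  followed by recursion costs at most \<open>h m + C * g m' + C * G / 2\<close>, because
  \<open>shrink\<close> fails with probability at most 1/2 and \<open>g\<close> is monotone. Since
  \<open>2 * h m \<le> C * G\<close>, this is at most \<open>C * g m\<close>. The set
  \<open>K\<close> passes knowledge about the target, which is invariant under recursion, to the
  bound on a round.\<close>

lemma ecost_select:
  fixes h g :: "nat \<Rightarrow> real" and C :: real
  assumes M: "0 < M" and D: "\<And>m. M \<le> m \<Longrightarrow> 6 \<le> D m \<and> D m ^ 6 \<le> m"
    and round: "\<And>X t. X \<subseteq> {..<n} \<Longrightarrow> t \<in> {1..card X} \<Longrightarrow> pick r X X t \<in> K \<Longrightarrow> M \<le> card X \<Longrightarrow>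
      (\<integral>\<^sup>+w. of_nat (tot c (pairs (fst w) (fst w)) +
        tot c (pairs X (all_pivots r (D (card X)) X t w))) \<partial>choices (D (card X)) X) \<le> ennreal (h (card X))"
    and base: "\<And>X. X \<subseteq> {..<n} \<Longrightarrow> X \<noteq> {} \<Longrightarrow> card X < M \<Longrightarrow> real (tot c (pairs X X)) \<le> C * g (card X)"
    and g: "mono g" "\<And>m. 0 \<le> g m" and C: "0 < C" and h: "\<And>m. 0 \<le> h m"
    and drop: "\<And>m. M \<le> m \<Longrightarrow> 2 * h m \<le> C * (g m - g (10 * m div D m))"
  shows "X \<subseteq> {..<n} \<Longrightarrow> t \<in> {1..card X} \<Longrightarrow> pick r X X t \<in> K \<Longrightarrow> card X \<le> k \<Longrightarrow>
    ecost c r (select D M k X t) \<le> ennreal (C * g (card X))"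
proof (induction k arbitrary: X t)
  case (Suc k)
  note X = Suc.prems(1) and t = Suc.prems(2)
  have fX: "finite X" "X \<noteq> {}" using X t fin by auto
  show ?case
  proof (cases "card X < M")
    case True
    then show ?thesis
      using base[OF X fX(2)] by (simp add: ecost_ask ennreal_of_nat_eq_real_of_nat ennreal_leI)
  next
    case False
    define m where "m = card X"
    have Mm: "M \<le> m" using False by (simp add: m_def)
    define d where "d = D m"
    define m' where "m' = 10 * m div d"
    define G where "G = g m - g m'"
    interpret round_setup r n X t d
      using X t D[OF Mm] by unfold_locales (auto simp: d_def m_def)
    define bad where "bad w \<longleftrightarrow> (\<forall>p\<in>P w. rnk r X p \<noteq> t) \<and> m' < card (mid r X (P w) t)" for w
    have hG: "2 * h m \<le> C * G" using drop[OF Mm] by (simp add: G_def m'_def d_def)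
    then have "0 \<le> C * G" using h[of m] by linarith
    then have G0: "0 \<le> G" using C by (simp add: zero_le_mult_iff)
    have cont: "ecost c r (continue r X t (select D M k) (P w)) \<le>
        ennreal (C * g m') + ennreal (C * G) * of_bool (bad w)"
      if w: "w \<in> set_pmf (choices d X)" for w
    proof (cases "\<exists>p\<in>P w. rnk r X p = t")
      case True
      then show ?thesis by (simp add: continue_def)
    next
      case False
      let ?X = "mid r X (P w) t" and ?t = "t - card (low r X (P w) t)"
      have no: "\<And>p. p \<in> P w \<Longrightarrow> rnk r X p \<noteq> t" using False by blast
      have PX: "P w \<subseteq> X" "P w \<noteq> {}" using all_pivots_subset[OF fX w] by auto
      note mp = mid_props[OF X PX(1) t no]
      obtain p where "p \<in> P w" using PX(2) by blast
      then have "card ?X < card X"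
        using mid_psubset[OF X PX(1) _ no] psubset_card_mono[OF fX(1)] by blast
      then have "ecost c r (select D M k ?X ?t) \<le> ennreal (C * g (card ?X))"
        using mp Suc.prems mid_subset[of r X "P w" t] by (intro Suc.IH) auto
      also have "\<dots> \<le> ennreal (C * g m' + C * G * of_bool (bad w))"
      proof (rule ennreal_leI)
        \<comment> \<open>In the bad case only \<open>card ?X < m\<close> is known, and
          \<open>g m\<close> equals \<open>g m' + G\<close>.\<close>
        have "g (card ?X) \<le> g m' + G * of_bool (bad w)"
        proof (cases "bad w")
          case True
          then show ?thesis
            using \<open>card ?X < card X\<close> monoD[OF g(1), of "card ?X" m] by (simp add: G_def m_def)
        next
          case False
          then show ?thesis using no monoD[OF g(1), of "card ?X" m'] by (auto simp: bad_def)
        qed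
        then have "C * g (card ?X) \<le> C * (g m' + G * of_bool (bad w))"
          using C by (intro mult_left_mono) auto
        then show "C * g (card ?X) \<le> C * g m' + C * G * of_bool (bad w)"
          by (simp only: distrib_left mult.assoc)
      qed
      also have "\<dots> = ennreal (C * g m') + ennreal (C * G) * of_bool (bad w)"
        using C g(2)[of m'] G0 by (cases "bad w") (simp_all add: ennreal_plus)
      finally show ?thesis using False by (simp add: continue_def)
    qed
    have "ecost c r (select D M (Suc k) X t) =
        (\<integral>\<^sup>+w. ecost c r (round_of d X t (select D M k) w) \<partial>choices d X)"
      using False by (simp add: ecost_Random d_def m_def)
    also have "\<dots> \<le> (\<integral>\<^sup>+w. of_nat (tot c (pairs (fst w) (fst w)) + tot c (pairs X (P w))) +
        (ennreal (C * g m') + ennreal (C * G) * of_bool (bad w)) \<partial>choices d X)"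
      by (intro nn_integral_mono_AE AE_pmfI) (simp only: ecost_round_of[OF fX] add_mono cont order.refl)
    also have "\<dots> = (\<integral>\<^sup>+w. of_nat (tot c (pairs (fst w) (fst w)) + tot c (pairs X (P w))) \<partial>choices d X) +
        (ennreal (C * g m') + ennreal (C * G) * (\<integral>\<^sup>+w. of_bool (bad w) \<partial>choices d X))"
      by (simp add: nn_integral_add nn_integral_cmult)
    also have "\<dots> \<le> ennreal (h m) + (ennreal (C * g m') + ennreal (C * G) * ennreal (1 / 2))"
    proof (intro add_mono mult_left_mono order.refl)
      show "(\<integral>\<^sup>+w. of_nat (tot c (pairs (fst w) (fst w)) + tot c (pairs X (P w))) \<partial>choices d X) \<le> ennreal (h m)"
        using round[OF X t Suc.prems(3)] Mm by (simp add: d_def m_def)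
      show "(\<integral>\<^sup>+w. of_bool (bad w) \<partial>choices d X) \<le> ennreal (1 / 2)"
        unfolding bad_def m'_def m_def using D[OF Mm] by (intro shrink) (simp add: d_def)
    qed simp
    also have "\<dots> = ennreal (h m + (C * g m' + C * G * (1 / 2)))"
      using h[of m] C g(2)[of m'] G0
      by (simp only: ennreal_mult[symmetric] ennreal_plus[symmetric] mult_nonneg_nonneg add_nonneg_nonneg
          less_imp_le zero_le_divide_1_iff zero_le_numeral)
    also have "\<dots> \<le> ennreal (C * g m)"
      using hG by (intro ennreal_leI) (simp add: G_def algebra_simps)
    finally show ?thesis by (simp add: m_def)
  qed
\<comment> \<open>For depth 0 the set would be empty, contradicting
  \<open>t \<in> {1..card X}\<close>.\<close>
qed simp

end

section \<open>The algorithm on a full input and its three cost measures\<close>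

definition sampled_select :: "(nat \<Rightarrow> nat) \<Rightarrow> nat \<Rightarrow> nat \<Rightarrow> nat \<Rightarrow> algo" where
  "sampled_select D M n t = select D M n {..<n} t"

lemma sampled_select_correct: "selects_correctly (sampled_select D M)"
  unfolding selects_correctly_def sampled_select_def
proof (safe)
  fix n t r v cs
  assume t: "t \<in> {1..n}" and lin: "linear_order_on {..<n} r"
    and v: "(v, cs) \<in> set_pmf (run r (select D M n {..<n} t))"
  interpret ordered_names r n by unfold_locales (rule lin)
  show "v = kth_smallest r t"
    using select_correct[OF order.refl _ v] t by (simp add: pick_kth_smallest)
qed

lemma finite_bigoI:
  assumes "\<And>n. F n \<le> ennreal (G n)" "\<And>n. 0 \<le> G n" "G \<in> O(f)"
  shows "finite_bigo F f"
  unfolding finite_bigo_def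
proof
  show "\<forall>n. F n < \<top>" using assms(1) by (meson ennreal_less_top le_less_trans)
  have "enn2real (F n) \<le> G n" for n
    using assms(1)[of n] assms(2)[of n] by (rule enn2real_leI[rotated])
  then have "(\<lambda>n. enn2real (F n)) \<in> O(G)"
    by (intro landau_o.bigI[of 1]) (auto simp: assms(2))
  then show "(\<lambda>n. enn2real (F n)) \<in> O(f)" using assms(3) by (rule landau_o.big_trans)
qed

text \<open>
  The expected cost \<open>h m\<close> of a round is paid for by a drop of the potential \<open>g\<close>: with
  probability at least one half, the next round starts with at most \<open>10 * m div D m\<close> elements.
\<close>

definition absorbs :: "(nat \<Rightarrow> nat) \<Rightarrow> (nat \<Rightarrow> real) \<Rightarrow> (nat \<Rightarrow> real) \<Rightarrow> nat \<Rightarrow> real \<Rightarrow> bool" where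
  "absorbs D h g M C \<longleftrightarrow> mono g \<and> (\<forall>m. 1 \<le> g m) \<and> 0 < C \<and>
     (\<forall>m\<ge>M. h m \<le> C * (g m - g (10 * m div D m)))"

definition admissible :: "(nat \<Rightarrow> nat) \<Rightarrow> nat \<Rightarrow> bool" where
  "admissible D M \<longleftrightarrow> 0 < M \<and> (\<forall>m\<ge>M. 6 \<le> D m \<and> D m ^ 6 \<le> m)"

lemma tot_le_length: "(\<And>x. c x \<le> 1) \<Longrightarrow> tot c xs \<le> length xs"
proof (induction xs)
  case (Cons x xs)
  then show ?case using add_mono[OF Cons.prems[of x] Cons.IH] by (simp add: tot_def)
qed (simp add: tot_def)

text \<open>In the constant, \<open>2 * C\<close> accounts for success with probability only 1/2 per
  round, and \<open>M ^ 2\<close> pays for comparing all pairs of fewer than \<open>M\<close>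
  elements, as \<open>g\<close> is at least 1.\<close>

lemma (in ordered_names) ecost_sampled_select:
  assumes adm: "admissible D M" and abs: "absorbs D h g M C"
    and c: "\<And>x. c x \<le> 1" and h: "\<And>m. 0 \<le> h m"
    and round: "\<And>X t. round_setup r n X t (D (card X)) \<Longrightarrow> pick r X X t \<in> K \<Longrightarrow>
      (\<integral>\<^sup>+w. of_nat (tot c (pairs (fst w) (fst w)) +
        tot c (pairs X (all_pivots r (D (card X)) X t w))) \<partial>choices (D (card X)) X) \<le> ennreal (h (card X))"
    and t: "t \<in> {1..n}" "kth_smallest r t \<in> K"
  shows "ecost c r (sampled_select D M n t) \<le> ennreal ((2 * C + real (M ^ 2)) * g n)"
proof -
  have C: "0 < C" and g: "mono g" "1 \<le> g m" for m
    using abs by (auto simp: absorbs_def)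
  have "ecost c r (select D M n {..<n} t) \<le> ennreal ((2 * C + real (M ^ 2)) * g (card {..<n}))"
  proof (rule ecost_select[where K = K and h = h])
    show "0 < M" "\<And>m. M \<le> m \<Longrightarrow> 6 \<le> D m \<and> D m ^ 6 \<le> m"
      using adm by (auto simp: admissible_def)
    show "0 \<le> g m" for m using g(2)[of m] by linarith
    show "2 * h m \<le> (2 * C + real (M ^ 2)) * (g m - g (10 * m div D m))" if "M \<le> m" for m
    proof -
      have le: "h m \<le> C * (g m - g (10 * m div D m))" using abs that by (simp add: absorbs_def)
      \<comment> \<open>Since \<open>h\<close> is nonnegative, so is the potential drop, and adding
        \<open>M ^ 2\<close> to the constant only weakens the requirement.\<close>
      with h[of m] have "0 \<le> C * (g m - g (10 * m div D m))" by linarith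
      then have "0 \<le> g m - g (10 * m div D m)" using C by (simp add: zero_le_mult_iff)
      then have "0 \<le> real (M ^ 2) * (g m - g (10 * m div D m))" by simp
      with le show ?thesis by (simp add: algebra_simps)
    qed
    show "real (tot c (pairs X X)) \<le> (2 * C + real (M ^ 2)) * g (card X)"
      if "X \<subseteq> {..<n}" "card X < M" for X
    proof -
      have "tot c (pairs X X) \<le> card X * card X"
        using tot_le_length[of c "pairs X X", OF c] fin[OF that(1)] by (simp add: length_pairs)
      also have "\<dots> \<le> M ^ 2"
        using that(2) by (simp add: power2_eq_square mult_mono)
      finally have "real (tot c (pairs X X)) \<le> real (M ^ 2) * 1" by (simp only: of_nat_le_iff mult_1_right)
      also have "\<dots> \<le> (2 * C + real (M ^ 2)) * g (card X)"
        using C g(2) by (intro mult_mono) auto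
      finally show ?thesis .
    qed
    show "(\<integral>\<^sup>+w. of_nat (tot c (pairs (fst w) (fst w)) +
        tot c (pairs X (all_pivots r (D (card X)) X t w))) \<partial>choices (D (card X)) X) \<le> ennreal (h (card X))"
      if X: "X \<subseteq> {..<n}" "t \<in> {1..card X}" "pick r X X t \<in> K" "M \<le> card X" for X t
    proof (rule round[OF _ X(3)])
      have "6 \<le> D (card X)" "D (card X) ^ 6 \<le> card X" using adm X(4) by (auto simp: admissible_def)
      then show "round_setup r n X t (D (card X))"
        using X by unfold_locales auto
    qed
    show "0 < 2 * C + real (M ^ 2)" using C by (intro add_pos_nonneg) auto
    show "pick r {..<n} {..<n} t \<in> K" unfolding pick_kth_smallest by (rule t)
  qed (use g C h t in auto)
  then show ?thesis by (simp add: sampled_select_def)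
qed

lemma exp_work_sampled_select:
  assumes "admissible D M" "absorbs D (\<lambda>m. 5 * real m) g M C"
  shows "exp_work (sampled_select D M) n \<le> ennreal ((2 * C + real (M ^ 2)) * g n)"
  unfolding exp_work_def
proof (intro SUP_least)
  fix t r assume t: "t \<in> {1..n}" and "r \<in> {r. linear_order_on {..<n} r}"
  then interpret ordered_names r n by unfold_locales simp
  have "ecost (\<lambda>_. 1) r (sampled_select D M n t) \<le> ennreal ((2 * C + real (M ^ 2)) * g n)"
    using assms t by (intro ecost_sampled_select[where K = UNIV, OF assms]) (auto dest: round_setup.round_work)
  then show "(\<integral>\<^sup>+(k, cs). of_nat (length cs) \<partial>measure_pmf (run r (sampled_select D M n t)))
      \<le> ennreal ((2 * C + real (M ^ 2)) * g n)"
    by (simp add: ecost_def tot_one[unfolded One_nat_def])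
qed

text \<open>Choosing \<open>K\<close> as the singleton of the target makes
  \<open>pivot_prob_selected\<close> applicable in every round; the round cost is then
  \<open>8 + card X * (1 / card X)\<close>, which is 9.\<close>

lemma exp_fmed_sampled_select:
  assumes "admissible D M" "absorbs D (\<lambda>m. 9) g M C"
  shows "exp_fmed (sampled_select D M) n \<le> ennreal ((2 * C + real (M ^ 2)) * g n)"
  unfolding exp_fmed_def
proof (intro SUP_least)
  fix t r assume t: "t \<in> {1..n}" and "r \<in> {r. linear_order_on {..<n} r}"
  then interpret ordered_names r n by unfold_locales simp
  let ?i = "kth_smallest r t"
  have "ecost (\<lambda>(a, b). of_bool (a = ?i \<or> b = ?i)) r (sampled_select D M n t)
      \<le> ennreal ((2 * C + real (M ^ 2)) * g n)"
  proof (rule ecost_sampled_select[where K = "{?i}", OF assms])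
    fix X t' assume rs: "round_setup r n X t' (D (card X))" and i: "pick r X X t' \<in> {?i}"
    interpret round_setup r n X t' "D (card X)" by (rule rs)
    have "?i \<in> X" "rnk r X ?i = t'" using pick_props[OF X t] i by auto
    from round_participation[OF pivot_prob_selected[OF this]]
    show "(\<integral>\<^sup>+w. of_nat (tot (\<lambda>(a, b). of_bool (a = ?i \<or> b = ?i)) (pairs (fst w) (fst w)) +
        tot (\<lambda>(a, b). of_bool (a = ?i \<or> b = ?i)) (pairs X (P w))) \<partial>choices (D (card X)) X) \<le> ennreal 9"
      using X_pos by simp
  qed (use t in auto)
  then show "(\<integral>\<^sup>+(k, cs). of_nat (participation ?i cs) \<partial>measure_pmf (run r (sampled_select D M n t)))
      \<le> ennreal ((2 * C + real (M ^ 2)) * g n)"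
    unfolding ecost_def by (simp only: tot_participation)
qed

lemma exp_frem_sampled_select:
  assumes "admissible D M" "absorbs D (\<lambda>m. 8 + real (D m) ^ 3) g M C"
  shows "exp_frem (sampled_select D M) n \<le> ennreal ((2 * C + real (M ^ 2)) * g n)"
  unfolding exp_frem_def
proof (intro SUP_least)
  fix t r i assume t: "t \<in> {1..n}" and "r \<in> {r. linear_order_on {..<n} r}"
  then interpret ordered_names r n by unfold_locales simp
  have "ecost (\<lambda>(a, b). of_bool (a = i \<or> b = i)) r (sampled_select D M n t)
      \<le> ennreal ((2 * C + real (M ^ 2)) * g n)"
  proof (rule ecost_sampled_select[where K = UNIV, OF assms])
    fix X t' assume rs: "round_setup r n X t' (D (card X))"
    interpret round_setup r n X t' "D (card X)" by (rule rs)
    from round_participation[OF pivot_prob[of i]]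
    show "(\<integral>\<^sup>+w. of_nat (tot (\<lambda>(a, b). of_bool (a = i \<or> b = i)) (pairs (fst w) (fst w)) +
        tot (\<lambda>(a, b). of_bool (a = i \<or> b = i)) (pairs X (P w))) \<partial>choices (D (card X)) X)
        \<le> ennreal (8 + real (D (card X)) ^ 3)"
      using X_pos q by simp
  qed (use t in auto)
  then show "(\<integral>\<^sup>+(k, cs). of_nat (participation i cs) \<partial>measure_pmf (run r (sampled_select D M n t)))
      \<le> ennreal ((2 * C + real (M ^ 2)) * g n)"
    unfolding ecost_def by (simp only: tot_participation)
qed

lemma absorbs_finite_bigo:
  assumes "absorbs D h g M C" "\<And>n. F n \<le> ennreal ((2 * C + real (M ^ 2)) * g n)" "g \<in> O(f)"
  shows "finite_bigo F f"
proof (rule finite_bigoI[OF assms(2)])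
  show "0 \<le> (2 * C + real (M ^ 2)) * g n" for n
    using assms(1) order.trans[OF zero_le_one, of "g n"] by (auto simp: absorbs_def)
  show "(\<lambda>n. (2 * C + real (M ^ 2)) * g n) \<in> O(f)"
  proof -
    have "2 * C + real (M ^ 2) \<noteq> 0"
      using assms(1) add_pos_nonneg[of "2 * C" "real (M ^ 2)"] by (simp add: absorbs_def)
    with assms(3) show ?thesis by simp
  qed
qed

text \<open>All three measures concern the same algorithm, so one threshold \<open>M\<close> has to
  serve them all. Stating each condition for all large \<open>M\<close> allows a common one to be
  chosen.\<close>

lemma sampled_select_bounds:
  assumes adm: "\<forall>\<^sub>F M in sequentially. admissible D M"
    and work: "\<forall>\<^sub>F M in sequentially. absorbs D (\<lambda>m. 5 * real m) g1 M C1" "g1 \<in> O(f1)"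
    and med: "\<forall>\<^sub>F M in sequentially. absorbs D (\<lambda>m. 9) g2 M C2" "g2 \<in> O(f2)"
    and rem: "\<forall>\<^sub>F M in sequentially. absorbs D (\<lambda>m. 8 + real (D m) ^ 3) g3 M C3" "g3 \<in> O(f3)"
  shows "\<exists>A. selects_correctly A \<and> finite_bigo (exp_work A) f1 \<and>
    finite_bigo (exp_fmed A) f2 \<and> finite_bigo (exp_frem A) f3"
proof -
  obtain M where M: "admissible D M" "absorbs D (\<lambda>m. 5 * real m) g1 M C1" "absorbs D (\<lambda>m. 9) g2 M C2"
    "absorbs D (\<lambda>m. 8 + real (D m) ^ 3) g3 M C3"
    using eventually_happens'[OF sequentially_bot eventually_conj[OF adm eventually_conj[OF work(1)
      eventually_conj[OF med(1) rem(1)]]]] by blast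
  show ?thesis
    using sampled_select_correct[of D M]
      absorbs_finite_bigo[OF M(2) exp_work_sampled_select[OF M(1,2)] work(2)]
      absorbs_finite_bigo[OF M(3) exp_fmed_sampled_select[OF M(1,3)] med(2)]
      absorbs_finite_bigo[OF M(4) exp_frem_sampled_select[OF M(1,4)] rem(2)]
    by blast
qed

text \<open>Removes the roundings: the floor of \<open>x\<close> exceeds \<open>x - 1\<close>,
  integer division is at most real division, and \<open>G\<close> is monotone. What remains is a
  smooth asymptotic inequality.\<close>

lemma absorbsI:
  fixes x :: "real \<Rightarrow> real" and G :: "real \<Rightarrow> real"
  assumes G: "mono_on {0..} G" "1 \<le> G 0" and C: "0 < C"
    and big: "\<forall>\<^sub>F m in sequentially. 2 \<le> x (real m)"
    and drop: "\<forall>\<^sub>F m in sequentially. h m \<le> C * (G (real m) - G (10 * real m / (x (real m) - 1)))"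
  shows "\<forall>\<^sub>F M in sequentially. absorbs (\<lambda>m. nat \<lfloor>x (real m)\<rfloor>) h (\<lambda>m. G (real m)) M C"
proof -
  have "mono (\<lambda>m. G (real m))"
    using G(1) by (intro monoI) (simp add: mono_on_def)
  moreover have "1 \<le> G (real m)" for m
    using G(2) mono_onD[OF G(1), of 0 "real m"] by simp
  moreover have "\<forall>\<^sub>F M in sequentially. \<forall>m\<ge>M. h m \<le> C * (G (real m) - G (real (10 * m div nat \<lfloor>x (real m)\<rfloor>)))"
  proof (rule eventually_all_ge_at_top)
    show "\<forall>\<^sub>F m in sequentially. h m \<le> C * (G (real m) - G (real (10 * m div nat \<lfloor>x (real m)\<rfloor>)))"
      using big drop
    proof eventually_elim
      case (elim m)
      define d where "d = nat \<lfloor>x (real m)\<rfloor>"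
      have d: "0 < d" "x (real m) - 1 < d" using elim(1) unfolding d_def by linarith+
      have "real (10 * m div d) \<le> real (10 * m) / d" by (rule div_bounds(1)[OF d(1)])
      also have "\<dots> \<le> 10 * real m / (x (real m) - 1)"
        using d elim(1) by (simp add: frac_le)
      finally have "G (real (10 * m div d)) \<le> G (10 * real m / (x (real m) - 1))"
        using elim(1) by (intro mono_onD[OF G(1)]) auto
      then have "C * (G (real m) - G (10 * real m / (x (real m) - 1))) \<le> C * (G (real m) - G (real (10 * m div d)))"
        using C by (intro mult_left_mono) auto
      with elim(2) show ?case by (simp add: d_def)
    qed
  qed
  ultimately show ?thesis
    using C by (simp add: absorbs_def)
qed

subsection \<open>The two trade-offs\<close>

lemma admissible_floor:
  assumes "\<forall>\<^sub>F m in sequentially. 6 \<le> x (real m)" "\<forall>\<^sub>F m in sequentially. x (real m) ^ 6 \<le> real m"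
  shows "\<forall>\<^sub>F M in sequentially. admissible (\<lambda>m. nat \<lfloor>x (real m)\<rfloor>) M"
proof -
  have "\<forall>\<^sub>F m in sequentially. 6 \<le> nat \<lfloor>x (real m)\<rfloor> \<and> nat \<lfloor>x (real m)\<rfloor> ^ 6 \<le> m"
    using assms
  proof eventually_elim
    case (elim m)
    have "real (nat \<lfloor>x (real m)\<rfloor> ^ 6) \<le> x (real m) ^ 6"
      using elim(1) unfolding of_nat_power by (intro power_mono) linarith+
    with elim have "real (nat \<lfloor>x (real m)\<rfloor> ^ 6) \<le> real m" by linarith
    then show ?case using elim(1) unfolding of_nat_le_iff by linarith
  qed
  from eventually_conj[OF eventually_gt_at_top[of 0] eventually_all_ge_at_top[OF this]]
  show ?thesis by (simp add: admissible_def)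
qed

lemma eventually_cube_floor:
  assumes "\<forall>\<^sub>F m in sequentially. 2 \<le> x (real m)" "\<forall>\<^sub>F m in sequentially. 8 + x (real m) ^ 3 \<le> H m"
  shows "\<forall>\<^sub>F m in sequentially. 8 + real (nat \<lfloor>x (real m)\<rfloor>) ^ 3 \<le> H m"
  using assms
proof eventually_elim
  case (elim m)
  have "real (nat \<lfloor>x (real m)\<rfloor>) ^ 3 \<le> x (real m) ^ 3"
    using elim(1) by (intro power_mono) linarith+
  with elim(2) show ?case by linarith
qed

text \<open>The shift by 3, which is at least e, keeps the inner logarithm at least 1 on all of the
  nonnegative reals.\<close>

lemma mono_ln_ln: "mono_on {0..} (\<lambda>x::real. 1 + ln (ln (x + 3)))"
proof (rule mono_onI)
  fix x y :: real assume x: "x \<in> {0..}" "x \<le> y"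
  have "1 \<le> ln (x + 3)"
    using exp_le x by (intro ln_ge_iff[THEN iffD2]) auto
  with x show "1 + ln (ln (x + 3)) \<le> 1 + ln (ln (y + 3))" by simp
qed

lemma mono_div_ln: "mono_on {exp 1..} (\<lambda>y::real. y / ln y)"
proof (rule mono_onI)
  fix x y :: real assume xy: "x \<in> {exp 1..}" "y \<in> {exp 1..}" "x \<le> y"
  show "x / ln x \<le> y / ln y"
  proof (rule DERIV_nonneg_imp_nondecreasing[OF xy(3)])
    fix z assume "x \<le> z" "z \<le> y"
    then have z: "exp 1 \<le> z" using xy by auto
    then have "0 < z" "1 \<le> ln z" using order.strict_trans2[OF exp_gt_zero z] by (auto simp: ln_ge_iff)
    then have "((\<lambda>y. y / ln y) has_real_derivative (ln z - 1) / (ln z)\<^sup>2) (at z)"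
      by (auto intro!: derivative_eq_intros simp: power2_eq_square)
    moreover have "0 \<le> (ln z - 1) / (ln z)\<^sup>2" using \<open>1 \<le> ln z\<close> by simp
    ultimately show "\<exists>D. ((\<lambda>y. y / ln y) has_real_derivative D) (at z) \<and> 0 \<le> D" by blast
  qed
qed

text \<open>The shift by 27 = 3^3, which is at least e^3, makes the logarithm at least 3 and thus
  places it where y / ln y increases, namely beyond e.\<close>

lemma mono_ln_div_ln_ln: "mono_on {0..} (\<lambda>x::real. 1 + ln (x + 27) / ln (ln (x + 27)))"
proof (rule mono_onI)
  fix x y :: real assume x: "x \<in> {0..}" "x \<le> y"
  have "exp 3 \<le> (27 :: real)"
    using power_mono[OF exp_le, of 3] by (simp flip: exp_of_nat_mult)
  then have "3 \<le> ln (x + 27)" using x by (intro ln_ge_iff[THEN iffD2]) auto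
  moreover have "ln (x + 27) \<le> ln (y + 27)" using x by simp
  moreover have "exp 1 \<le> (3 :: real)" by (rule exp_le)
  ultimately show "1 + ln (x + 27) / ln (ln (x + 27)) \<le> 1 + ln (y + 27) / ln (ln (y + 27))"
    using mono_onD[OF mono_div_ln, of "ln (x + 27)" "ln (y + 27)"] by simp
qed

lemma select_sqrt:
  "\<exists>A. selects_correctly A \<and> finite_bigo (exp_work A) (\<lambda>n. real n) \<and>
     finite_bigo (exp_fmed A) (\<lambda>n. ln (ln (real n))) \<and> finite_bigo (exp_frem A) (\<lambda>n. sqrt (real n))"
proof -
  have two: "\<forall>\<^sub>F m in sequentially. 2 \<le> real m powr (1/6)" by real_asymp
  have six: "\<forall>\<^sub>F m in sequentially. (real m powr (1/6)) ^ 6 \<le> real m"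
    using eventually_gt_at_top[of 0] by eventually_elim (simp add: powr_power)
  have ln_ln: "\<forall>\<^sub>F m in sequentially. 9 \<le> 100 * ((1 + ln (ln (real m + 3)))
      - (1 + ln (ln (10 * real m / (real m powr (1/6) - 1) + 3))))"
  proof -
    \<comment> \<open>The next size is about 10 m^(5/6), so the logarithm shrinks by the factor 5/6
      in the limit and ln ln drops by a constant.\<close>
    have "(\<lambda>m. ln (ln (real m + 3)) - ln (ln (10 * real m / (real m powr (1/6) - 1) + 3)))
        \<longlonglongrightarrow> - ln (5/6)"
      by real_asymp
    \<comment> \<open>The inequality ln (1 + x) \<le> x at x = -1/6 gives a drop of at least 1/6,
      which explains the generous constant 100 for a round cost of 9.\<close>
    moreover have "9 / 100 < - ln (5/6 :: real)"
      using ln_add_one_self_le_self2[of "-1/6 :: real"] by simp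
    ultimately have "\<forall>\<^sub>F m in sequentially. 9 / 100 < ln (ln (real m + 3))
        - ln (ln (10 * real m / (real m powr (1/6) - 1) + 3))"
      by (rule order_tendstoD)
    then show ?thesis by eventually_elim (simp add: algebra_simps)
  qed
  show ?thesis
  proof (rule sampled_select_bounds)
    show "\<forall>\<^sub>F M in sequentially. admissible (\<lambda>m. nat \<lfloor>real m powr (1/6)\<rfloor>) M"
      by (rule admissible_floor[OF _ six]) real_asymp
    show "\<forall>\<^sub>F M in sequentially. absorbs (\<lambda>m. nat \<lfloor>real m powr (1/6)\<rfloor>) (\<lambda>m. 5 * real m) (\<lambda>m. 1 + real m) M 6"
      by (rule absorbsI[where G = "\<lambda>x. 1 + x" and x = "\<lambda>y. y powr (1/6)"])
        (simp_all add: mono_on_def two, real_asymp)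
    show "\<forall>\<^sub>F M in sequentially. absorbs (\<lambda>m. nat \<lfloor>real m powr (1/6)\<rfloor>) (\<lambda>m. 9) (\<lambda>m. 1 + ln (ln (real m + 3))) M 100"
    proof (rule absorbsI[where G = "\<lambda>x. 1 + ln (ln (x + 3))" and x = "\<lambda>y. y powr (1/6)", OF mono_ln_ln _ _ two ln_ln])
      have "1 \<le> ln (3 :: real)" using exp_le by (intro ln_ge_iff[THEN iffD2]) auto
      then show "1 \<le> 1 + ln (ln (0 + 3 :: real))" by simp
    qed simp
    show "\<forall>\<^sub>F M in sequentially. absorbs (\<lambda>m. nat \<lfloor>real m powr (1/6)\<rfloor>) (\<lambda>m. 8 + real (nat \<lfloor>real m powr (1/6)\<rfloor>) ^ 3)
        (\<lambda>m. 1 + sqrt (real m)) M 2"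
    proof (rule absorbsI[where G = "\<lambda>x. 1 + sqrt x" and x = "\<lambda>y. y powr (1/6)", OF _ _ _ two])
      \<comment> \<open>The cube of m^(1/6) is the square root of m, while the potential left after
        a successful round is of lower order.\<close>
      show "\<forall>\<^sub>F m in sequentially. 8 + real (nat \<lfloor>real m powr (1/6)\<rfloor>) ^ 3
          \<le> 2 * ((1 + sqrt (real m)) - (1 + sqrt (10 * real m / (real m powr (1/6) - 1))))"
        by (rule eventually_cube_floor[OF two]) real_asymp
    qed (simp_all add: mono_on_def)
  qed real_asymp+
qed

lemma select_polylog:
  "\<exists>A. selects_correctly A \<and> finite_bigo (exp_work A) (\<lambda>n. real n) \<and>
     finite_bigo (exp_fmed A) (\<lambda>n. ln (real n) / ln (ln (real n))) \<and>
     finite_bigo (exp_frem A) (\<lambda>n. (ln (real n))\<^sup>2)"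
proof -
  have two: "\<forall>\<^sub>F m in sequentially. 2 \<le> ln (real m) powr (1/3)" by real_asymp
  show ?thesis
  proof (rule sampled_select_bounds)
    show "\<forall>\<^sub>F M in sequentially. admissible (\<lambda>m. nat \<lfloor>ln (real m) powr (1/3)\<rfloor>) M"
      by (rule admissible_floor; real_asymp)
    show "\<forall>\<^sub>F M in sequentially. absorbs (\<lambda>m. nat \<lfloor>ln (real m) powr (1/3)\<rfloor>) (\<lambda>m. 5 * real m) (\<lambda>m. 1 + real m) M 6"
      by (rule absorbsI[where G = "\<lambda>x. 1 + x" and x = "\<lambda>y. ln y powr (1/3)"])
        (simp_all add: mono_on_def two, real_asymp)
    show "\<forall>\<^sub>F M in sequentially. absorbs (\<lambda>m. nat \<lfloor>ln (real m) powr (1/3)\<rfloor>) (\<lambda>m. 9)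
        (\<lambda>m. 1 + ln (real m + 27) / ln (ln (real m + 27))) M 100"
    proof (rule absorbsI[where G = "\<lambda>x. 1 + ln (x + 27) / ln (ln (x + 27))" and x = "\<lambda>y. ln y powr (1/3)",
        OF mono_ln_div_ln_ln _ _ two])
      have "1 \<le> ln (27 :: real)" using exp_le by (intro ln_ge_iff[THEN iffD2]) auto
      then show "1 \<le> 1 + ln (0 + 27) / ln (ln (0 + 27 :: real))" by simp
      \<comment> \<open>A round lowers ln m by about (1/3) ln ln m, and y / ln y has slope about 1 /
        ln y at y = ln m, so the potential drops by about 1/3.\<close>
      show "\<forall>\<^sub>F m in sequentially. 9 \<le> 100 * ((1 + ln (real m + 27) / ln (ln (real m + 27)))
          - (1 + ln (10 * real m / (ln (real m) powr (1/3) - 1) + 27)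
              / ln (ln (10 * real m / (ln (real m) powr (1/3) - 1) + 27))))"
        by real_asymp
    qed simp
    show "\<forall>\<^sub>F M in sequentially. absorbs (\<lambda>m. nat \<lfloor>ln (real m) powr (1/3)\<rfloor>)
        (\<lambda>m. 8 + real (nat \<lfloor>ln (real m) powr (1/3)\<rfloor>) ^ 3) (\<lambda>m. 1 + (ln (real m + 1))\<^sup>2) M 2"
    proof (rule absorbsI[where G = "\<lambda>x. 1 + (ln (x + 1))\<^sup>2" and x = "\<lambda>y. ln y powr (1/3)", OF _ _ _ two])
      \<comment> \<open>The drop of (ln m)^2 is of order ln m times ln ln m, which dominates the
        round cost of about ln m.\<close>
      show "\<forall>\<^sub>F m in sequentially. 8 + real (nat \<lfloor>ln (real m) powr (1/3)\<rfloor>) ^ 3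
          \<le> 2 * ((1 + (ln (real m + 1))\<^sup>2) - (1 + (ln (10 * real m / (ln (real m) powr (1/3) - 1) + 1))\<^sup>2))"
        by (rule eventually_cube_floor[OF two]) real_asymp
    qed (auto intro!: mono_onI power_mono)
  qed real_asymp+
qed

theorem theorem21:
  shows "(\<exists>A. selects_correctly A \<and>
            finite_bigo (exp_work A) (\<lambda>n. real n) \<and>
            finite_bigo (exp_fmed A) (\<lambda>n. ln (ln (real n))) \<and>
            finite_bigo (exp_frem A) (\<lambda>n. sqrt (real n))) \<and>
         (\<exists>A. selects_correctly A \<and>
            finite_bigo (exp_work A) (\<lambda>n. real n) \<and>
            finite_bigo (exp_fmed A) (\<lambda>n. ln (real n) / ln (ln (real n))) \<and>
            finite_bigo (exp_frem A) (\<lambda>n. (ln (real n))\<^sup>2))"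
  using select_sqrt select_polylog by blast

end
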